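(* Let $G$ be a connected real analytic Lie group admitting a faithful finite dimensional representation, embedded in its linear complexification $G^{\mathbb C}$, which is assumed simply-connected, and let $\mathfrak g$ be the Lie algebra of $G$. Let $\mathbb D\subset\mathbb C$ be a simply-connected domain and let $\xi$ be a meromorphic $1$-form on $\mathbb D$ with values in $\mathfrak g^{\mathbb C}$. Put $\mathcal N(z,\lambda)=(\lambda^{-1}\xi(z),-\lambda^{-1}\xi(z))$ and let $\mathcal R_-$ be a solution of $d\mathcal R_-=\mathcal R_-\mathcal N$, with initial condition in $G^{\mathbb C}\times G^{\mathbb C}$ at some base point $z_0\in\mathbb D$, which is meromorphic in $z$ and takes values in the twisted loop group $\Lambda\mathcal G^{\mathbb C}_\sigma$. On an open set of points $z\in\mathbb D$ which are not poles of $\mathcal R_-$ and for which $\mathcal R_-(z,\cdot)$ lies in the Iwasawa big cell $\Lambda\mathcal G_\sigma\cdot\Lambda^+\mathcal G^{\mathbb C}_\sigma$, let $$\mathcal R_-=\mathcal F\,\mathcal W_+,\qquad \mathcal F(z,\bar z,\lambda)=\big(F(z,\bar z,\lambda),F(z,\bar z,-\lambda)\big)\in\Lambda\mathcal G_\sigma,\quad \mathcal W_+\in\Lambda^+\mathcal G^{\mathbb C}_\sigma,$$ be an Iwasawa decomposition depending smoothly on $z$, and set $$\hat F(z,\bar z,\lambda)=F(z,\bar z,\lambda)F(z,\bar z,1)^{-1}.$$ Then the map $\varphi(z,\bar z):=\hat F(z,\bar z,-1)$ into $G$ is ${}^{(0)}\nabla$-harmonic. Moreover, $$\hat\varphi(z,\bar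 z,\lambda)=\hat F(z,\bar z,-\lambda)\,\hat F(z,\bar z,\lambda)^{-1}$$ is a harmonic map into $(G,{}^{(0)}\nabla)$ for all $\lambda\in\mathbb S^1$, and $\hat F(z,\bar z,\lambda)$ is an extended solution of $\varphi$.
   Context: $\Lambda G^{\mathbb C}$ is the loop group of maps $\gamma:\mathbb S^1\to G^{\mathbb C}$, equipped with a weighted Wiener topology making it a Banach Lie group; $\Lambda G=\{\gamma\in\Lambda G^{\mathbb C}:\gamma(\lambda)\in G\}$; $\Lambda^+G^{\mathbb C}$ is the subgroup of $\gamma$ such that $\gamma$ and $\gamma^{-1}$ extend holomorphically to the unit disk. The twisted groups are $$\Lambda\mathcal G^{\mathbb C}_\sigma=\{(g(\lambda),g(-\lambda)):g\in\Lambda G^{\mathbb C}\},\quad\Lambda\mathcal G_\sigma=\{(g(\lambda),g(-\lambda)):g\in\Lambda G\},\quad\Lambda^+\mathcal G^{\mathbb C}_\sigma=\{(g(\lambda),g(-\lambda)):g\in\Lambda^+G^{\mathbb C}\}.$$ The neutral connection ${}^{(0)}\nabla$ on $G$ is the bi-invariant connection with ${}^{(0)}\nabla_XY=\frac12[X,Y]$ for left-invariant vector fields $X,Y$. A smooth map $\varphi$ from a Riemann surface $M$ into a manifold with affine connection $\nabla$ is $\nabla$-harmonic if $\mathrm{tr}_g(\nabla d\varphi)=0$ for a (any) Hermitian metric $g$ in the conformal class, where $(\nabla d\varphi)(Y;X)=\nabla^\varphi_Xd\varphi(Y)-d\varphi(\nabla^M_XY)$, $\nabla^\varphi$ is the induced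 connection on the pull-back tangent bundle and $\nabla^M$ the Levi-Civita connection of $g$. With $\theta$ the left Maurer-Cartan form of $G$ and $\alpha=\varphi^*\theta=\alpha'+\alpha''$ its decomposition into $(1,0)$- and $(0,1)$-parts, an extended solution of $\varphi$ is a family $F_\lambda$ of $G$-valued maps, $\lambda\in\mathbb S^1$, with $F_\lambda^*\theta=\alpha_\lambda:=\frac12(1-\lambda^{-1})\alpha'+\frac12(1-\lambda)\alpha''$. *)

theory Defs
  imports "HOL-Complex_Analysis.Complex_Analysis"
begin

unbundle no fps_syntax

type_synonym 'n cmat = "complex ^ 'n ^ 'n"

definition cscale :: "complex \<Rightarrow> 'n::finite cmat \<Rightarrow> 'n cmat"  (infixr \<open>*\<^sub>m\<close> 75)
  where "c *\<^sub>m A = (\<chi> i j. c * A $ i $ j)"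

definition commutator :: "'n::finite cmat \<Rightarrow> 'n cmat \<Rightarrow> 'n cmat"
  where "commutator A B = A ** B - B ** A"

primrec mat_pow :: "'n::finite cmat \<Rightarrow> nat \<Rightarrow> 'n cmat" where
  "mat_pow A 0 = mat 1"
| "mat_pow A (Suc k) = A ** mat_pow A k"

definition mat_exp :: "'n::finite cmat \<Rightarrow> 'n cmat"
  where "mat_exp A = (\<Sum>k. (1 / fact k) *\<^sub>R mat_pow A k)"

section \<open>Linear Lie groups\<close>

definition mat_subgroup :: "'n::finite cmat set \<Rightarrow> bool"
  where "mat_subgroup H \<longleftrightarrow>
    mat 1 \<in> H \<and>
    (\<forall>A\<in>H. invertible A \<and> matrix_inv A \<in> H) \<and>
    (\<forall>A\<in>H. \<forall>B\<in>H. A ** B \<in> H)"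

text \<open>The tangent space at the identity: the velocities of the continuously differentiable
  curves that run in the group.\<close>

definition lie_algebra :: "'n::finite cmat set \<Rightarrow> 'n cmat set"
  where "lie_algebra H = {X. \<exists>\<epsilon>>0. \<exists>c c'.
    (\<forall>t\<in>{-\<epsilon><..<\<epsilon>::real}. c t \<in> H \<and> (c has_vector_derivative c' t) (at t)) \<and>
    continuous_on {-\<epsilon><..<\<epsilon>} c' \<and> c 0 = mat 1 \<and> c' 0 = X}"

text \<open>A faithful finite dimensional representation identifies a connected Lie group with a
  (possibly not closed) connected Lie subgroup of \<open>GL(n,\<complex>)\<close>, that is, with a subgroup generated
  by the exponentials of its Lie algebra. Such a subgroup is an initial submanifold: a curve, a
  homotopy or a smooth map into the matrices with values in the subgroup is continuous
  (respectively smooth) for its Lie group structure as well. So neither \<open>lie_algebra\<close>, nor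
  \<open>simply_connected\<close>, nor smoothness depends on which of the two structures is used.\<close>

definition connected_linear_lie_group :: "'n::finite cmat set \<Rightarrow> bool"
  where "connected_linear_lie_group H \<longleftrightarrow>
    mat_subgroup H \<and>
    H = \<Inter>{K. mat_subgroup K \<and> mat_exp ` lie_algebra H \<subseteq> K}"

definition complexify :: "'n::finite cmat set \<Rightarrow> 'n cmat set"
  where "complexify \<gg> = {X + \<i> *\<^sub>m Y | X Y. X \<in> \<gg> \<and> Y \<in> \<gg>}"

text \<open>The last condition says that the complex span of the Lie algebra \<open>\<gg>\<close> of \<open>G\<close> inside the
  matrices is \<open>\<gg> \<otimes> \<complex>\<close>.\<close>

definition linear_complexification :: "'n::finite cmat set \<Rightarrow> 'n cmat set \<Rightarrow> bool"
  where "linear_complexification G GC \<longleftrightarrow>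
    connected_linear_lie_group G \<and> connected_linear_lie_group GC \<and> G \<subseteq> GC \<and>
    lie_algebra GC = complexify (lie_algebra G) \<and>
    (\<forall>X\<in>lie_algebra G. \<i> *\<^sub>m X \<in> lie_algebra G \<longrightarrow> X = 0)"

section \<open>Loop groups\<close>

text \<open>Loops are functions on \<open>\<complex>\<close> of which only the values on the unit circle matter.\<close>

definition admissible_weight :: "(int \<Rightarrow> real) \<Rightarrow> bool"
  where "admissible_weight w \<longleftrightarrow>
    (\<forall>n. 1 \<le> w n) \<and> (\<forall>n. w (- n) = w n) \<and> (\<forall>m n. w (m + n) \<le> w m * w n) \<and>
    (\<lambda>n::nat. w (int n) powr (1 / real n)) \<longlonglongrightarrow> 1"

definition fourier_coeff :: "(complex \<Rightarrow> 'n::finite cmat) \<Rightarrow> int \<Rightarrow> 'n cmat"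
  where "fourier_coeff \<gamma> n =
    (1 / (2 * pi)) *\<^sub>R integral {0..2 * pi} (\<lambda>t. cis (- (of_int n * t)) *\<^sub>m \<gamma> (cis t))"

definition wiener_loop :: "(int \<Rightarrow> real) \<Rightarrow> (complex \<Rightarrow> 'n::finite cmat) \<Rightarrow> bool"
  where "wiener_loop w \<gamma> \<longleftrightarrow>
    (\<lambda>n. w n * norm (fourier_coeff \<gamma> n)) summable_on UNIV \<and>
    (\<forall>l\<in>sphere 0 1. ((\<lambda>n. (l powi n) *\<^sub>m fourier_coeff \<gamma> n) has_sum \<gamma> l) UNIV)"

definition wiener_norm :: "(int \<Rightarrow> real) \<Rightarrow> (complex \<Rightarrow> 'n::finite cmat) \<Rightarrow> real"
  where "wiener_norm w \<gamma> = (\<Sum>\<^sub>\<infinity>n. w n * norm (fourier_coeff \<gamma> n))"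

text \<open>For \<open>H = G\<^sup>\<complex>\<close> this is \<open>\<Lambda>G\<^sup>\<complex>\<close>, and for \<open>H = G\<close> it is \<open>\<Lambda>G\<close>.\<close>

definition loop_group :: "(int \<Rightarrow> real) \<Rightarrow> 'n::finite cmat set \<Rightarrow> (complex \<Rightarrow> 'n cmat) set"
  where "loop_group w H = {\<gamma>. wiener_loop w \<gamma> \<and> (\<forall>l\<in>sphere 0 1. \<gamma> l \<in> H)}"

definition extends_to_disk :: "(complex \<Rightarrow> 'n::finite cmat) \<Rightarrow> bool"
  where "extends_to_disk \<gamma> \<longleftrightarrow> (\<exists>h.
    continuous_on (cball 0 1) h \<and> (\<forall>i j. (\<lambda>l. h l $ i $ j) holomorphic_on ball 0 1) \<and>
    (\<forall>l\<in>sphere 0 1. h l = \<gamma> l))"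

definition plus_loop_group :: "(int \<Rightarrow> real) \<Rightarrow> 'n::finite cmat set \<Rightarrow> (complex \<Rightarrow> 'n cmat) set"
  where "plus_loop_group w GC = {\<gamma> \<in> loop_group w GC.
    extends_to_disk \<gamma> \<and> extends_to_disk (\<lambda>l. matrix_inv (\<gamma> l))}"

definition twisted :: "(complex \<Rightarrow> 'n::finite cmat) set \<Rightarrow> (complex \<Rightarrow> 'n cmat \<times> 'n cmat) set"
  where "twisted L = {\<Gamma>. \<exists>g\<in>L. \<forall>l\<in>sphere 0 1. \<Gamma> l = (g l, g (- l))}"

definition pair_mult ::
    "'n::finite cmat \<times> 'n cmat \<Rightarrow> 'n cmat \<times> 'n cmat \<Rightarrow> 'n cmat \<times> 'n cmat"
    (infixl \<open>**\<^sub>2\<close> 70)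
  where "P **\<^sub>2 Q = (fst P ** fst Q, snd P ** snd Q)"

definition iwasawa_big_cell ::
    "(int \<Rightarrow> real) \<Rightarrow> 'n::finite cmat set \<Rightarrow> 'n cmat set \<Rightarrow> (complex \<Rightarrow> 'n cmat \<times> 'n cmat) set"
  where "iwasawa_big_cell w G GC = {\<Gamma>.
    \<exists>A\<in>twisted (loop_group w G). \<exists>B\<in>twisted (plus_loop_group w GC).
      \<forall>l\<in>sphere 0 1. \<Gamma> l = A l **\<^sub>2 B l}"

section \<open>Smooth maps\<close>

text \<open>Below \<open>fx\<close> and \<open>fy\<close> are the partial derivatives with respect to the real coordinates of
  \<open>z = x + \<i> y\<close>. The sets are meant to be open.\<close>

primrec Ck_on :: "nat \<Rightarrow> complex set \<Rightarrow> (complex \<Rightarrow> 'b::real_normed_vector) \<Rightarrow> bool" where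
  "Ck_on 0 U f \<longleftrightarrow> continuous_on U f"
| "Ck_on (Suc k) U f \<longleftrightarrow> (\<exists>fx fy.
     (\<forall>z\<in>U. (f has_derivative (\<lambda>h. Re h *\<^sub>R fx z + Im h *\<^sub>R fy z)) (at z)) \<and>
     Ck_on k U fx \<and> Ck_on k U fy)"

definition smooth_map_on :: "complex set \<Rightarrow> (complex \<Rightarrow> 'b::real_normed_vector) \<Rightarrow> bool"
  where "smooth_map_on U f \<longleftrightarrow> (\<forall>k. Ck_on k U f)"

text \<open>The same for maps into the Banach space of loops with the weighted Wiener norm.\<close>

primrec loop_Ck_on ::
    "(int \<Rightarrow> real) \<Rightarrow> nat \<Rightarrow> complex set \<Rightarrow> (complex \<Rightarrow> complex \<Rightarrow> 'n::finite cmat) \<Rightarrow> bool" where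
  "loop_Ck_on w 0 U f \<longleftrightarrow>
     (\<forall>z\<in>U. wiener_loop w (f z)) \<and>
     (\<forall>z\<in>U. ((\<lambda>\<zeta>. wiener_norm w (\<lambda>l. f \<zeta> l - f z l)) \<longlongrightarrow> 0) (at z))"
| "loop_Ck_on w (Suc k) U f \<longleftrightarrow>
     (\<forall>z\<in>U. wiener_loop w (f z)) \<and>
     (\<exists>fx fy.
       (\<forall>z\<in>U. ((\<lambda>h. wiener_norm w (\<lambda>l. f (z + h) l - f z l
                 - (Re h *\<^sub>R fx z l + Im h *\<^sub>R fy z l)) / norm h) \<longlongrightarrow> 0) (at 0)) \<and>
       loop_Ck_on w k U fx \<and> loop_Ck_on w k U fy)"

definition smooth_loop_map_on ::
    "(int \<Rightarrow> real) \<Rightarrow> complex set \<Rightarrow> (complex \<Rightarrow> complex \<Rightarrow> 'n::finite cmat) \<Rightarrow> bool"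
  where "smooth_loop_map_on w U f \<longleftrightarrow> (\<forall>k. loop_Ck_on w k U f)"

section \<open>Meromorphic matrices\<close>

text \<open>\<open>nicely_meromorphic_on\<close> only normalises the irrelevant values at isolated singularities: a
  removable one is removed, and the value at a pole is \<open>0\<close>.\<close>

definition mat_meromorphic_on :: "(complex \<Rightarrow> 'n::finite cmat) \<Rightarrow> complex set \<Rightarrow> bool"
  where "mat_meromorphic_on f D \<longleftrightarrow> (\<forall>i j. (\<lambda>z. f z $ i $ j) nicely_meromorphic_on D)"

definition mat_pole :: "(complex \<Rightarrow> 'n::finite cmat) \<Rightarrow> complex \<Rightarrow> bool"
  where "mat_pole f z \<longleftrightarrow> (\<exists>i j. is_pole (\<lambda>\<zeta>. f \<zeta> $ i $ j) z)"

text \<open>For a family depending on the loop parameter, with values in pairs of matrices.\<close>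

definition loop_meromorphic_on ::
    "(complex \<Rightarrow> complex \<Rightarrow> 'n::finite cmat \<times> 'n cmat) \<Rightarrow> complex set \<Rightarrow> bool"
  where "loop_meromorphic_on R D \<longleftrightarrow> (\<forall>l\<in>sphere 0 1.
    mat_meromorphic_on (\<lambda>z. fst (R z l)) D \<and> mat_meromorphic_on (\<lambda>z. snd (R z l)) D)"

definition loop_pole ::
    "(complex \<Rightarrow> complex \<Rightarrow> 'n::finite cmat \<times> 'n cmat) \<Rightarrow> complex \<Rightarrow> bool"
  where "loop_pole R z \<longleftrightarrow> (\<exists>l\<in>sphere 0 1.
    mat_pole (\<lambda>\<zeta>. fst (R \<zeta> l)) z \<or> mat_pole (\<lambda>\<zeta>. snd (R \<zeta> l)) z)"

text \<open>A meromorphic 1-form \<open>\<xi> dz\<close> is given by its coefficient function \<open>\<xi>\<close>; the value of the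
  form \<open>(\<lambda>\<^sup>-\<^sup>1 \<xi> dz, - \<lambda>\<^sup>-\<^sup>1 \<xi> dz)\<close> on the tangent vector \<open>h\<close> is as follows.\<close>

definition potential ::
    "(complex \<Rightarrow> 'n::finite cmat) \<Rightarrow> complex \<Rightarrow> complex \<Rightarrow> complex \<Rightarrow> 'n cmat \<times> 'n cmat"
  where "potential \<xi> z l h = ((inverse l * h) *\<^sub>m \<xi> z, - ((inverse l * h) *\<^sub>m \<xi> z))"

section \<open>Harmonic maps\<close>

definition maurer_cartan :: "(complex \<Rightarrow> 'n::finite cmat) \<Rightarrow> complex \<Rightarrow> complex \<Rightarrow> 'n cmat"
  where "maurer_cartan f z h = matrix_inv (f z) ** frechet_derivative f (at z) h"

text \<open>Connections are left-invariant and given by a bilinear map \<open>\<beta>\<close>: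
  \<open>\<nabla>\<^sub>X Y = \<beta>(X, Y)\<close> for left-invariant vector fields. A vector field along \<open>\<phi>\<close> is
  \<open>V = \<Sum>\<^sub>a v\<^sub>a (E\<^sub>a \<circ> \<phi>)\<close> in a left-invariant frame \<open>E\<^sub>a(g) = g e\<^sub>a\<close>, hence
  \<open>\<nabla>\<^sup>\<phi>\<^sub>X V = \<Sum>\<^sub>a (X v\<^sub>a) (E\<^sub>a \<circ> \<phi>) + v\<^sub>a \<nabla>\<^bsub>d\<phi>(X)\<^esub> E\<^sub>a\<close> is \<open>\<phi>\<close> times
  \<open>X(\<phi>\<^sup>-\<^sup>1 V) + \<beta>(\<phi>\<^sup>-\<^sup>1 d\<phi>(X), \<phi>\<^sup>-\<^sup>1 V)\<close>.\<close>

definition pullback_connection ::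
    "('n::finite cmat \<Rightarrow> 'n cmat \<Rightarrow> 'n cmat) \<Rightarrow> (complex \<Rightarrow> 'n cmat) \<Rightarrow>
     (complex \<Rightarrow> complex) \<Rightarrow> (complex \<Rightarrow> 'n cmat) \<Rightarrow> complex \<Rightarrow> 'n cmat"
  where "pullback_connection \<beta> \<phi> X V z =
    \<phi> z ** (frechet_derivative (\<lambda>p. matrix_inv (\<phi> p) ** V p) (at z) (X z)
            + \<beta> (maurer_cartan \<phi> z (X z)) (matrix_inv (\<phi> z) ** V z))"

definition neutral :: "'n::finite cmat \<Rightarrow> 'n cmat \<Rightarrow> 'n cmat"
  where "neutral A B = (1 / 2) *\<^sub>R commutator A B"

text \<open>The Levi-Civita connection of \<open>\<rho> (dx\<^sup>2 + dy\<^sup>2)\<close>, by the Koszul formula: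
  \<open>\<nabla>\<^sub>X Y = D\<^sub>X Y + (d\<rho>(X) Y + d\<rho>(Y) X - \<langle>X, Y\<rangle> grad \<rho>) / (2 \<rho>)\<close>, with \<open>D\<close>, \<open>grad\<close> and the
  inner product Euclidean.\<close>

definition levi_civita ::
    "(complex \<Rightarrow> real) \<Rightarrow> (complex \<Rightarrow> complex) \<Rightarrow> (complex \<Rightarrow> complex) \<Rightarrow> complex \<Rightarrow> complex"
  where "levi_civita \<rho> X Y z =
    (let d\<rho> = frechet_derivative \<rho> (at z) in
     frechet_derivative Y (at z) (X z)
     + (1 / (2 * \<rho> z)) *\<^sub>R
       (d\<rho> (X z) *\<^sub>R Y z + d\<rho> (Y z) *\<^sub>R X z - inner (X z) (Y z) *\<^sub>R Complex (d\<rho> 1) (d\<rho> \<i>)))"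

text \<open>\<open>(\<nabla>d\<phi>)(Y; X)\<close>\<close>

definition second_fundamental_form ::
    "('n::finite cmat \<Rightarrow> 'n cmat \<Rightarrow> 'n cmat) \<Rightarrow> (complex \<Rightarrow> real) \<Rightarrow> (complex \<Rightarrow> 'n cmat) \<Rightarrow>
     (complex \<Rightarrow> complex) \<Rightarrow> (complex \<Rightarrow> complex) \<Rightarrow> complex \<Rightarrow> 'n cmat"
  where "second_fundamental_form \<beta> \<rho> \<phi> Y X z =
    pullback_connection \<beta> \<phi> X (\<lambda>p. frechet_derivative \<phi> (at p) (Y p)) z
    - frechet_derivative \<phi> (at z) (levi_civita \<rho> X Y z)"

text \<open>The trace is taken in the orthonormal frame \<open>\<partial>\<^sub>x / \<surd>\<rho>, \<partial>\<^sub>y / \<surd>\<rho>\<close>.\<close>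

definition tension_field ::
    "('n::finite cmat \<Rightarrow> 'n cmat \<Rightarrow> 'n cmat) \<Rightarrow> (complex \<Rightarrow> real) \<Rightarrow> (complex \<Rightarrow> 'n cmat) \<Rightarrow>
     complex \<Rightarrow> 'n cmat"
  where "tension_field \<beta> \<rho> \<phi> z =
    (\<Sum>e\<in>{1, \<i>}. second_fundamental_form \<beta> \<rho> \<phi>
        (\<lambda>p. e / of_real (sqrt (\<rho> p))) (\<lambda>p. e / of_real (sqrt (\<rho> p))) z)"

text \<open>Harmonicity on an open set \<open>U\<close> of the plane; \<open>\<rho>\<close> ranges over all Hermitian metrics in the
  conformal class.\<close>

definition harmonic_map_on ::
    "('n::finite cmat \<Rightarrow> 'n cmat \<Rightarrow> 'n cmat) \<Rightarrow> 'n cmat set \<Rightarrow> complex set \<Rightarrow>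
     (complex \<Rightarrow> 'n cmat) \<Rightarrow> bool"
  where "harmonic_map_on \<beta> G U \<phi> \<longleftrightarrow>
    smooth_map_on U \<phi> \<and> \<phi> ` U \<subseteq> G \<and>
    (\<forall>\<rho>. smooth_map_on U \<rho> \<and> (\<forall>z\<in>U. 0 < \<rho> z) \<longrightarrow> (\<forall>z\<in>U. tension_field \<beta> \<rho> \<phi> z = 0))"

definition part10 :: "(complex \<Rightarrow> 'n::finite cmat) \<Rightarrow> complex \<Rightarrow> 'n cmat"
  where "part10 \<alpha> h = (1 / 2) *\<^sub>R (\<alpha> h - \<i> *\<^sub>m \<alpha> (\<i> * h))"

definition part01 :: "(complex \<Rightarrow> 'n::finite cmat) \<Rightarrow> complex \<Rightarrow> 'n cmat"
  where "part01 \<alpha> h = (1 / 2) *\<^sub>R (\<alpha> h + \<i> *\<^sub>m \<alpha> (\<i> * h))"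

definition extended_solution ::
    "'n::finite cmat set \<Rightarrow> complex set \<Rightarrow> (complex \<Rightarrow> 'n cmat) \<Rightarrow>
     (complex \<Rightarrow> complex \<Rightarrow> 'n cmat) \<Rightarrow> bool"
  where "extended_solution G U \<phi> E \<longleftrightarrow>
    (\<forall>l\<in>sphere 0 1.
      smooth_map_on U (\<lambda>z. E z l) \<and> (\<forall>z\<in>U. E z l \<in> G) \<and>
      (\<forall>z\<in>U. \<forall>h. maurer_cartan (\<lambda>\<zeta>. E \<zeta> l) z h =
         ((1 - inverse l) / 2) *\<^sub>m part10 (maurer_cartan \<phi> z) h
         + ((1 - l) / 2) *\<^sub>m part01 (maurer_cartan \<phi> z) h))"

end

theory Submission
  imports Defs
begin

text \<open>Fix a point \<open>z\<close> and write \<open>R = F w\<close> for the first components of the Iwasawa decomposition; the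
  second ones are the same loops at \<open>- \<lambda>\<close>. Since \<open>dR = R \<lambda>\<inverse> \<xi> dz\<close>,
  \<open>F\<inverse> dF = (\<lambda>\<inverse> w \<xi> dz - dw) w\<inverse>\<close>.
  As \<open>w\<close>, \<open>w\<inverse>\<close> and \<open>dw\<close> extend holomorphically to the disk, the right-hand side has at most a simple
  pole at \<open>\<lambda> = 0\<close>, and the residue is a multiple of \<open>dz\<close>. On the other hand \<open>F\<close> runs in \<open>G\<close> for
  \<open>\<lambda>\<close> on the circle, so \<open>F\<inverse> dF\<close> takes values in the real Lie algebra and its Fourier coefficients of
  opposite index are conjugate. Hence (\<open>iwasawa_logarithmic_derivative\<close>)
  \<open>F\<inverse> dF = \<lambda>\<inverse> B dz + A + \<lambda> C d(cnj z)\<close> for a 1-form \<open>A\<close> that does not depend on \<open>\<lambda>\<close>.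

  Everything else follows from this shape. Dividing by \<open>F\<close> at \<open>\<lambda> = 1\<close> is a gauge transformation that
  removes \<open>A\<close>: with \<open>B'\<close> and \<open>C'\<close> the conjugates of \<open>B\<close> and \<open>C\<close> by \<open>F\<close> at \<open>\<lambda> = 1\<close>, the logarithmic
  derivative of \<open>F_hat\<close> is \<open>(\<lambda>\<inverse> - 1) B' dz + (\<lambda> - 1) C' d(cnj z)\<close>. At \<open>\<lambda> = - 1\<close> it is
  \<open>- 2 B' dz - 2 C' d(cnj z)\<close>, and comparison gives the equation of an extended solution.

  For the neutral connection the bracket term of the tension field of \<open>\<psi>\<close> vanishes, because it is
  evaluated on equal arguments, and the conformal factor of the metric drops out. What remains is the
  divergence of \<open>\<psi>\<inverse> d\<psi>\<close> (\<open>tension_field_neutral\<close>). The maps in question are all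
  \<open>F(- \<mu>) F(\<mu>)\<inverse>\<close>; the value \<open>\<mu> = 1\<close> gives \<open>\<phi>\<close>. The divergence of their logarithmic derivative turns out
  to be the part odd in \<open>\<lambda>\<close> of the Maurer-Cartan equation of \<open>F\<close> at \<open>\<lambda> = \<i> \<mu>\<close>, because multiplication
  of \<open>\<lambda>\<close> by \<open>\<i>\<close> acts on \<open>\<lambda>\<inverse> B dz + \<lambda> C d(cnj z)\<close> as the Hodge star, up to sign
  (\<open>quotient_divergence_eq_0\<close>).\<close>

unbundle no Formal_Power_Series.fps_syntax

section \<open>Matrix calculus\<close>

lemma bounded_bilinear_matrix_mult:
  "bounded_bilinear ((**) :: 'n::finite cmat \<Rightarrow> 'n cmat \<Rightarrow> 'n cmat)"
  unfolding bilinear_conv_bounded_bilinear[symmetric]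
  by (auto simp: bilinear_def linear_iff matrix_matrix_mult_def vec_eq_iff scaleR_sum_right
      sum.distrib algebra_simps)

interpretation matmul: bounded_bilinear "(**) :: 'n::finite cmat \<Rightarrow> 'n cmat \<Rightarrow> 'n cmat"
  by (rule bounded_bilinear_matrix_mult)

lemma bounded_bilinear_cscale:
  "bounded_bilinear (cscale :: complex \<Rightarrow> 'n::finite cmat \<Rightarrow> 'n cmat)"
  unfolding bilinear_conv_bounded_bilinear[symmetric]
  by (auto simp: bilinear_def linear_iff cscale_def vec_eq_iff algebra_simps)

interpretation cscale: bounded_bilinear "cscale :: complex \<Rightarrow> 'n::finite cmat \<Rightarrow> 'n cmat"
  by (rule bounded_bilinear_cscale)

lemma cscale_nth [simp]: "(c *\<^sub>m A) $ i $ j = c * A $ i $ j"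
  by (simp add: cscale_def)

lemma cscale_cscale [simp]: "c *\<^sub>m d *\<^sub>m A = (c * d) *\<^sub>m A"
  by (simp add: vec_eq_iff)

lemma cscale_one [simp]: "1 *\<^sub>m A = A"
  by (simp add: vec_eq_iff)

lemma cscale_of_real: "of_real r *\<^sub>m A = r *\<^sub>R A"
  by (simp add: vec_eq_iff scaleR_conv_of_real[where 'a = complex])

lemma cscale_mult_left [simp]: "(c *\<^sub>m A) ** B = c *\<^sub>m (A ** B)"
  by (simp add: vec_eq_iff matrix_matrix_mult_def sum_distrib_left mult.assoc)

lemma cscale_mult_right [simp]: "A ** (c *\<^sub>m B) = c *\<^sub>m (A ** B)"
  by (simp add: vec_eq_iff matrix_matrix_mult_def sum_distrib_left algebra_simps)

lemma bounded_linear_entry: "bounded_linear (\<lambda>A::'n::finite cmat. A $ i $ j)"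
  using bounded_linear_compose[OF bounded_linear_vec_nth bounded_linear_vec_nth] .

lemma norm_cscale: "norm (c *\<^sub>m A) = norm c * norm A"
proof -
  have "norm (c *\<^sub>m A) = L2_set (\<lambda>i. norm c * L2_set (\<lambda>j. norm (A $ i $ j)) UNIV) UNIV"
    by (simp add: norm_vec_def norm_mult L2_set_right_distrib)
  also have "\<dots> = norm c * norm A"
    by (simp add: norm_vec_def L2_set_right_distrib)
  finally show ?thesis .
qed

lemma matrix_inv_inverse:
  fixes A :: "'n::finite cmat"
  assumes "invertible A"
  shows "A ** matrix_inv A = mat 1" "matrix_inv A ** A = mat 1"
proof -
  have "\<exists>B. A ** B = mat 1 \<and> B ** A = mat 1"
    using assms by (simp add: invertible_def)
  from someI_ex[OF this] show "A ** matrix_inv A = mat 1" "matrix_inv A ** A = mat 1"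
    by (simp_all add: matrix_inv_def)
qed

lemma matrix_inv_unique:
  fixes A :: "'n::finite cmat"
  assumes "A ** B = mat 1"
  shows "matrix_inv A = B"
proof -
  have "invertible A"
    using assms invertible_right_inverse by blast
  then have "matrix_inv A = matrix_inv A ** (A ** B)" "matrix_inv A ** A = mat 1"
    by (simp_all add: assms matrix_inv_inverse)
  then show ?thesis
    by (simp add: matrix_mul_assoc)
qed

lemma mult_inv_cancel:
  fixes A :: "'n::finite cmat"
  assumes "invertible A"
  shows "matrix_inv A ** (A ** B) = B" "A ** (matrix_inv A ** B) = B"
    "B ** A ** matrix_inv A = B" "B ** matrix_inv A ** A = B"
proof -
  show "matrix_inv A ** (A ** B) = B" "A ** (matrix_inv A ** B) = B"
    by (simp_all add: matrix_mul_assoc matrix_inv_inverse assms)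
  show "B ** A ** matrix_inv A = B" "B ** matrix_inv A ** A = B"
    by (simp_all add: matrix_inv_inverse assms flip: matrix_mul_assoc)
qed

lemma invertible_matrix_inv:
  fixes A :: "'n::finite cmat"
  shows "invertible A \<Longrightarrow> invertible (matrix_inv A)"
  unfolding invertible_def using matrix_inv_inverse[unfolded invertible_def] by blast

lemma matrix_inv_mult:
  fixes A B :: "'n::finite cmat"
  assumes "invertible A" "invertible B"
  shows "matrix_inv (A ** B) = matrix_inv B ** matrix_inv A"
  by (rule matrix_inv_unique)
     (simp add: matrix_mul_assoc mult_inv_cancel matrix_inv_inverse assms)

lemma matrix_inv_matrix_inv:
  fixes A :: "'n::finite cmat"
  shows "invertible A \<Longrightarrow> matrix_inv (matrix_inv A) = A"
  by (rule matrix_inv_unique) (simp add: matrix_inv_inverse)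

text \<open>Inversion is continuous because \<open>A\<inverse> - B\<inverse> = A\<inverse> (B - A) B\<inverse>\<close>. This identity first
  bounds \<open>A\<inverse>\<close> for \<open>A\<close> near \<open>B\<close>, and then forces the difference to tend to \<open>0\<close>.\<close>

lemma tendsto_matrix_inv:
  fixes f :: "'a \<Rightarrow> 'n::finite cmat"
  assumes lim: "(f \<longlongrightarrow> B) H" and B: "invertible B"
    and inv: "\<forall>\<^sub>F x in H. invertible (f x)"
  shows "((\<lambda>x. matrix_inv (f x)) \<longlongrightarrow> matrix_inv B) H"
proof -
  obtain K where K: "K > 0" "\<And>(P::'n cmat) (Q::'n cmat). norm (P ** Q) \<le> norm P * norm Q * K"
    using matmul.pos_bounded by blast
  define b where "b = norm (matrix_inv B)"
  have diff: "matrix_inv A - matrix_inv B = matrix_inv A ** ((B - A) ** matrix_inv B)"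
    if "invertible A" for A :: "'n cmat"
    by (simp add: matmul.diff_left matmul.diff_right mult_inv_cancel matrix_inv_inverse that B)
  have le: "norm (matrix_inv A - matrix_inv B) \<le> norm (matrix_inv A) * (norm (A - B) * b * K\<^sup>2)"
    if "invertible A" for A :: "'n cmat"
  proof -
    have "norm (matrix_inv A - matrix_inv B) \<le> norm (matrix_inv A) * norm ((B - A) ** matrix_inv B) * K"
      unfolding diff[OF that] by (rule K)
    also have "\<dots> \<le> norm (matrix_inv A) * (norm (B - A) * norm (matrix_inv B) * K) * K"
      using K by (intro mult_right_mono mult_left_mono) auto
    finally show ?thesis
      by (simp add: b_def norm_minus_commute power2_eq_square mult_ac)
  qed
  have lim0: "((\<lambda>x. norm (f x - B) * b * K\<^sup>2) \<longlongrightarrow> 0) H"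
    using lim by (intro tendsto_mult_left_zero tendsto_norm_zero) (simp add: LIM_zero)
  have ev: "\<forall>\<^sub>F x in H. norm (f x - B) * b * K\<^sup>2 < 1/2"
    using lim0 by (rule order_tendstoD) simp
  have "\<forall>\<^sub>F x in H. norm (matrix_inv (f x) - matrix_inv B) \<le> (2 * b) * (norm (f x - B) * b * K\<^sup>2)"
    using ev inv
  proof eventually_elim
    case (elim x)
    have "norm (matrix_inv (f x)) * (norm (f x - B) * b * K\<^sup>2) \<le> norm (matrix_inv (f x)) * (1/2)"
      using elim by (intro mult_left_mono) auto
    with le[of "f x"] elim have "norm (matrix_inv (f x) - matrix_inv B) \<le> norm (matrix_inv (f x)) / 2"
      by simp
    then have "norm (matrix_inv (f x)) \<le> 2 * b"
      using norm_triangle_ineq2[of "matrix_inv (f x)" "matrix_inv B"] unfolding b_def by linarith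
    then have "norm (matrix_inv (f x)) * (norm (f x - B) * b * K\<^sup>2) \<le> 2 * b * (norm (f x - B) * b * K\<^sup>2)"
      by (intro mult_right_mono) (auto simp: b_def)
    then show ?case
      using le[of "f x"] elim by linarith
  qed
  then have "((\<lambda>x. matrix_inv (f x) - matrix_inv B) \<longlongrightarrow> 0) H"
    by (rule Lim_null_comparison) (intro tendsto_mult_right_zero lim0)
  then show ?thesis
    by (simp add: LIM_zero_iff)
qed

text \<open>The remainder of \<open>f\<inverse>\<close> is the remainder \<open>q\<close> of \<open>f\<close> between \<open>- f(x)\<inverse>\<close> and \<open>f(z)\<inverse>\<close>, plus a term with
  the factor \<open>f(x)\<inverse> - f(z)\<inverse>\<close> next to a bounded difference quotient \<open>r\<close>.\<close>

lemma has_derivative_matrix_inv: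
  fixes f :: "'a::real_normed_vector \<Rightarrow> 'n::finite cmat"
  assumes f: "(f has_derivative f') (at z)" and U: "open U" "z \<in> U"
    and inv: "\<And>x. x \<in> U \<Longrightarrow> invertible (f x)"
  shows "((\<lambda>x. matrix_inv (f x)) has_derivative
           (\<lambda>h. - (matrix_inv (f z) ** f' h ** matrix_inv (f z)))) (at z)"
proof -
  let ?g = "\<lambda>x. matrix_inv (f x)"
  have ev: "\<forall>\<^sub>F x in at z. x \<in> U"
    using U by (simp add: eventually_at_topological) blast
  have cont: "(?g \<longlongrightarrow> ?g z) (at z)"
  proof (rule tendsto_matrix_inv)
    show "(f \<longlongrightarrow> f z) (at z)"
      using has_derivative_continuous[OF f] by (simp add: isCont_def)
    show "\<forall>\<^sub>F x in at z. invertible (f x)"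
      using ev by eventually_elim (rule inv)
  qed (use U inv in auto)
  have lin: "bounded_linear f'"
    using f by (rule has_derivative_bounded_linear)
  obtain K where K: "\<And>h. norm (f' h) \<le> norm h * K"
    using bounded_linear.bounded[OF lin] by blast
  obtain L where L: "L > 0" "\<And>(P::'n cmat) (Q::'n cmat). norm (P ** Q) \<le> norm P * norm Q * L"
    using matmul.pos_bounded by blast
  let ?q = "\<lambda>x. (1 / norm (x - z)) *\<^sub>R (f x - f z - f' (x - z))"
  let ?r = "\<lambda>x. (1 / norm (x - z)) *\<^sub>R f' (x - z)"
  have q: "(?q \<longlongrightarrow> 0) (at z)"
    using f by (simp add: has_derivative_at_within divide_inverse algebra_simps)
  have "((\<lambda>x. norm (?g x - ?g z) * K * L) \<longlongrightarrow> 0) (at z)"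
    using cont by (intro tendsto_mult_left_zero tendsto_norm_zero) (simp add: LIM_zero)
  moreover have "\<forall>\<^sub>F x in at z. norm ((?g x - ?g z) ** ?r x) \<le> norm (?g x - ?g z) * K * L"
    using eventually_neq_at_within[of z]
  proof eventually_elim
    case (elim x)
    have "norm (?r x) \<le> K"
      using K[of "x - z"] elim by (simp add: divide_le_eq mult.commute)
    then have "norm (?g x - ?g z) * norm (?r x) * L \<le> norm (?g x - ?g z) * K * L"
      using L by (intro mult_right_mono mult_left_mono) auto
    with L(2) show ?case
      by (rule order_trans)
  qed
  ultimately have r: "((\<lambda>x. (?g x - ?g z) ** ?r x) \<longlongrightarrow> 0) (at z)"
    by (rule Lim_null_comparison[rotated])
  have "((\<lambda>x. - (?g x ** ?q x ** ?g z) - (?g x - ?g z) ** ?r x ** ?g z)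
      \<longlongrightarrow> - (?g z ** 0 ** ?g z) - 0 ** ?g z) (at z)"
    by (intro tendsto_intros matmul.tendsto cont q r)
  moreover have "\<forall>\<^sub>F x in at z. - (?g x ** ?q x ** ?g z) - (?g x - ?g z) ** ?r x ** ?g z =
      (1 / norm (x - z)) *\<^sub>R (?g x - ?g z - - (?g z ** f' (x - z) ** ?g z))"
    using ev
  proof eventually_elim
    case (elim x)
    have "?g x ** f x ** ?g z = ?g z" "?g x ** f z ** ?g z = ?g x"
      using U inv elim by (simp_all add: mult_inv_cancel matrix_inv_inverse)
    then have "- (?g x ** (f x - f z - f' (x - z)) ** ?g z) - (?g x - ?g z) ** f' (x - z) ** ?g z =
        ?g x - ?g z - - (?g z ** f' (x - z) ** ?g z)"
      by (simp only: matmul.diff_left matmul.diff_right) simp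
    from arg_cong[OF this, of "(*\<^sub>R) (1 / norm (x - z))"] show ?case
      unfolding matmul.scaleR_left matmul.scaleR_right
      by (simp only: scaleR_right_diff_distrib scaleR_minus_right)
  qed
  ultimately have "((\<lambda>x. (1 / norm (x - z)) *\<^sub>R (?g x - ?g z - - (?g z ** f' (x - z) ** ?g z)))
      \<longlongrightarrow> 0) (at z)"
    by (simp add: matmul.zero_left matmul.zero_right filterlim_cong)
  moreover have "bounded_linear (\<lambda>h. - (?g z ** f' h ** ?g z))"
    by (intro bounded_linear_minus bounded_linear_compose[OF matmul.bounded_linear_left]
        bounded_linear_compose[OF matmul.bounded_linear_right] lin)
  ultimately show ?thesis
    by (simp add: has_derivative_at_within divide_inverse)
qed

section \<open>Smooth maps on open subsets of the plane\<close>

definition dx :: "(complex \<Rightarrow> 'b::real_normed_vector) \<Rightarrow> complex \<Rightarrow> 'b"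
  where "dx f z = frechet_derivative f (at z) 1"

definition dy :: "(complex \<Rightarrow> 'b::real_normed_vector) \<Rightarrow> complex \<Rightarrow> 'b"
  where "dy f z = frechet_derivative f (at z) \<i>"

lemma dx_dy_eqI:
  assumes "(f has_derivative D) (at z)"
  shows "dx f z = D 1" "dy f z = D \<i>"
  using frechet_derivative_at[OF assms] by (simp_all add: dx_def dy_def)

lemma dx_dy_cong:
  assumes "open U" "z \<in> U" "\<And>z. z \<in> U \<Longrightarrow> f z = g z" "f differentiable at z"
  shows "dx f z = dx g z" "dy f z = dy g z"
proof -
  have "(f has_derivative frechet_derivative f (at z)) (at z)"
    using assms(4) by (simp add: frechet_derivative_works)
  then have "(g has_derivative frechet_derivative f (at z)) (at z)"
    using assms(1-3) by (rule has_derivative_transform_within_open)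
  from dx_dy_eqI[OF this] show "dx f z = dx g z" "dy f z = dy g z"
    by (simp_all add: dx_def dy_def)
qed

lemma has_derivative_dx_dy:
  assumes "f differentiable at z"
  shows "(f has_derivative (\<lambda>h. Re h *\<^sub>R dx f z + Im h *\<^sub>R dy f z)) (at z)"
proof -
  let ?D = "frechet_derivative f (at z)"
  have D: "(f has_derivative ?D) (at z)"
    using assms by (simp add: frechet_derivative_works)
  then interpret bounded_linear ?D
    by (rule has_derivative_bounded_linear)
  have "?D = (\<lambda>h. Re h *\<^sub>R dx f z + Im h *\<^sub>R dy f z)"
  proof
    fix h
    have "?D (Re h *\<^sub>R 1 + Im h *\<^sub>R \<i>) = Re h *\<^sub>R dx f z + Im h *\<^sub>R dy f z"
      by (simp only: add scaleR dx_def dy_def)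
    moreover have "Re h *\<^sub>R 1 + Im h *\<^sub>R \<i> = h"
      by (simp add: complex_eq_iff)
    ultimately show "?D h = Re h *\<^sub>R dx f z + Im h *\<^sub>R dy f z"
      by simp
  qed
  with D show ?thesis
    by simp
qed

lemma frechet_derivative_dx_dy:
  assumes "f differentiable at z"
  shows "frechet_derivative f (at z) h = Re h *\<^sub>R dx f z + Im h *\<^sub>R dy f z"
  using frechet_derivative_at[OF has_derivative_dx_dy[OF assms]] by metis

lemma Ck_on_cong:
  assumes "open U" "\<And>z. z \<in> U \<Longrightarrow> f z = g z" "Ck_on k U f"
  shows "Ck_on k U g"
proof (cases k)
  case 0
  with assms show ?thesis
    using continuous_on_cong by force
next
  case (Suc l)
  with assms obtain fx fy where f:
    "\<forall>z\<in>U. (f has_derivative (\<lambda>h. Re h *\<^sub>R fx z + Im h *\<^sub>R fy z)) (at z)"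
    "Ck_on l U fx" "Ck_on l U fy"
    by auto
  have "\<forall>z\<in>U. (g has_derivative (\<lambda>h. Re h *\<^sub>R fx z + Im h *\<^sub>R fy z)) (at z)"
    using f(1) assms(1,2) has_derivative_transform_within_open by blast
  with f Suc show ?thesis
    by auto
qed

text \<open>The partial derivatives that \<open>Ck_on\<close> only asserts to exist are unique, so a single choice serves
  all orders of differentiability.\<close>

lemma Ck_on_Suc_iff:
  assumes "open U"
  shows "Ck_on (Suc k) U f \<longleftrightarrow>
    (\<forall>z\<in>U. f differentiable at z) \<and> Ck_on k U (dx f) \<and> Ck_on k U (dy f)"
proof
  assume "Ck_on (Suc k) U f"
  then obtain fx fy where f:
    "\<And>z. z \<in> U \<Longrightarrow> (f has_derivative (\<lambda>h. Re h *\<^sub>R fx z + Im h *\<^sub>R fy z)) (at z)"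
    "Ck_on k U fx" "Ck_on k U fy"
    by auto
  have "fx z = dx f z" "fy z = dy f z" if "z \<in> U" for z
    using dx_dy_eqI[OF f(1)[OF that]] by auto
  with f assms show "(\<forall>z\<in>U. f differentiable at z) \<and> Ck_on k U (dx f) \<and> Ck_on k U (dy f)"
    by (auto intro: Ck_on_cong simp: differentiable_def)
next
  assume "(\<forall>z\<in>U. f differentiable at z) \<and> Ck_on k U (dx f) \<and> Ck_on k U (dy f)"
  then show "Ck_on (Suc k) U f"
    using has_derivative_dx_dy by (auto intro!: exI)
qed

lemma Ck_on_differentiable: "Ck_on (Suc k) U f \<Longrightarrow> z \<in> U \<Longrightarrow> f differentiable at z"
  by (auto simp: differentiable_def)

lemma Ck_on_imp_continuous_on: "Ck_on k U f \<Longrightarrow> continuous_on U f"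
  by (cases k) (auto intro: continuous_at_imp_continuous_on has_derivative_continuous)

lemma Ck_on_SucD: "Ck_on (Suc k) U f \<Longrightarrow> Ck_on k U f"
proof (induction k arbitrary: f)
  case 0
  then show ?case
    using Ck_on_imp_continuous_on by fastforce
next
  case (Suc k)
  from Suc.prems obtain fx fy where
    "\<forall>z\<in>U. (f has_derivative (\<lambda>h. Re h *\<^sub>R fx z + Im h *\<^sub>R fy z)) (at z)"
    "Ck_on (Suc k) U fx" "Ck_on (Suc k) U fy"
    by (subst (asm) Ck_on.simps(2)) blast
  with Suc.IH show ?case
    by (subst Ck_on.simps(2)) blast
qed

lemma Ck_on_bounded_linear:
  assumes L: "bounded_linear L" and "Ck_on k U f"
  shows "Ck_on k U (\<lambda>z. L (f z))"
  using assms(2)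
proof (induction k arbitrary: f)
  case 0
  then show ?case
    using bounded_linear.continuous_on[OF L] by auto
next
  case (Suc k)
  interpret bounded_linear L by fact
  from Suc.prems obtain fx fy where f:
    "\<forall>z\<in>U. (f has_derivative (\<lambda>h. Re h *\<^sub>R fx z + Im h *\<^sub>R fy z)) (at z)"
    "Ck_on k U fx" "Ck_on k U fy"
    by auto
  have "((\<lambda>z. L (f z)) has_derivative (\<lambda>h. Re h *\<^sub>R L (fx z) + Im h *\<^sub>R L (fy z))) (at z)"
    if "z \<in> U" for z
    using has_derivative[OF f(1)[rule_format, OF that]] by (simp add: add scaleR)
  with Suc.IH[OF f(2)] Suc.IH[OF f(3)] show ?case
    by (auto intro!: exI)
qed

lemma Ck_on_add:
  assumes "Ck_on k U f" "Ck_on k U g"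
  shows "Ck_on k U (\<lambda>z. f z + g z)"
  using assms
proof (induction k arbitrary: f g)
  case 0
  then show ?case
    by (auto intro: continuous_intros)
next
  case (Suc k)
  from Suc.prems obtain fx fy where f:
    "\<forall>z\<in>U. (f has_derivative (\<lambda>h. Re h *\<^sub>R fx z + Im h *\<^sub>R fy z)) (at z)"
    "Ck_on k U fx" "Ck_on k U fy"
    by auto
  from Suc.prems obtain gx gy where g:
    "\<forall>z\<in>U. (g has_derivative (\<lambda>h. Re h *\<^sub>R gx z + Im h *\<^sub>R gy z)) (at z)"
    "Ck_on k U gx" "Ck_on k U gy"
    by auto
  have "((\<lambda>z. f z + g z) has_derivative
      (\<lambda>h. Re h *\<^sub>R (fx z + gx z) + Im h *\<^sub>R (fy z + gy z))) (at z)" if "z \<in> U" for z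
    using has_derivative_add[OF f(1)[rule_format, OF that] g(1)[rule_format, OF that]]
    by (simp add: algebra_simps)
  with Suc.IH[OF f(2) g(2)] Suc.IH[OF f(3) g(3)] show ?case
    by (auto intro!: exI)
qed

lemma Ck_on_bounded_bilinear:
  assumes B: "bounded_bilinear B" and "Ck_on k U f" "Ck_on k U g"
  shows "Ck_on k U (\<lambda>z. B (f z) (g z))"
  using assms(2,3)
proof (induction k arbitrary: f g)
  case 0
  then show ?case
    using bounded_bilinear.continuous_on[OF B] by auto
next
  case (Suc k)
  interpret bounded_bilinear B by fact
  from Suc.prems obtain fx fy where f:
    "\<forall>z\<in>U. (f has_derivative (\<lambda>h. Re h *\<^sub>R fx z + Im h *\<^sub>R fy z)) (at z)"
    "Ck_on k U fx" "Ck_on k U fy"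
    by auto
  from Suc.prems obtain gx gy where g:
    "\<forall>z\<in>U. (g has_derivative (\<lambda>h. Re h *\<^sub>R gx z + Im h *\<^sub>R gy z)) (at z)"
    "Ck_on k U gx" "Ck_on k U gy"
    by auto
  note fg = Suc.prems[THEN Ck_on_SucD]
  have "((\<lambda>z. B (f z) (g z)) has_derivative
      (\<lambda>h. Re h *\<^sub>R (B (f z) (gx z) + B (fx z) (g z)) + Im h *\<^sub>R (B (f z) (gy z) + B (fy z) (g z)))) (at z)"
    if "z \<in> U" for z
    using FDERIV[OF f(1)[rule_format, OF that] g(1)[rule_format, OF that]]
    by (simp add: add_left add_right scaleR_left scaleR_right algebra_simps)
  moreover have "Ck_on k U (\<lambda>z. B (f z) (gx z) + B (fx z) (g z))"
    "Ck_on k U (\<lambda>z. B (f z) (gy z) + B (fy z) (g z))"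
    by (intro Ck_on_add Suc.IH f g fg)+
  ultimately show ?case
    by (auto intro!: exI)
qed

text \<open>The derivative of \<open>f\<inverse>\<close> is a product of \<open>f\<inverse>\<close> and the derivative of \<open>f\<close>, so each order of
  differentiability of \<open>f\<inverse>\<close> follows from the preceding one.\<close>

lemma Ck_on_matrix_inv:
  fixes f :: "complex \<Rightarrow> 'n::finite cmat"
  assumes U: "open U" and inv: "\<And>z. z \<in> U \<Longrightarrow> invertible (f z)" and "Ck_on k U f"
  shows "Ck_on k U (\<lambda>z. matrix_inv (f z))"
  using assms(3)
proof (induction k)
  case 0
  have "((\<lambda>z. matrix_inv (f z)) \<longlongrightarrow> matrix_inv (f z)) (at z within U)" if "z \<in> U" for z
  proof (rule tendsto_matrix_inv)
    show "(f \<longlongrightarrow> f z) (at z within U)"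
      using 0 that by (simp add: continuous_on_def)
    show "\<forall>\<^sub>F x in at z within U. invertible (f x)"
      using inv by (simp add: eventually_at_filter)
  qed (use inv that in auto)
  then show ?case
    by (simp add: continuous_on_def)
next
  case (Suc k)
  let ?g = "\<lambda>z. matrix_inv (f z)"
  from Suc.prems obtain fx fy where f:
    "\<forall>z\<in>U. (f has_derivative (\<lambda>h. Re h *\<^sub>R fx z + Im h *\<^sub>R fy z)) (at z)"
    "Ck_on k U fx" "Ck_on k U fy"
    by auto
  have g: "Ck_on k U ?g"
    using Suc Ck_on_SucD by blast
  have "(?g has_derivative (\<lambda>h. Re h *\<^sub>R - (?g z ** fx z ** ?g z) + Im h *\<^sub>R - (?g z ** fy z ** ?g z))) (at z)"
    if "z \<in> U" for z
    using has_derivative_matrix_inv[OF f(1)[rule_format, OF that] U that inv]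
    by (simp add: matmul.add_left matmul.add_right matmul.scaleR_left matmul.scaleR_right)
  moreover have "Ck_on k U (\<lambda>z. - (?g z ** fx z ** ?g z))" "Ck_on k U (\<lambda>z. - (?g z ** fy z ** ?g z))"
    by (intro Ck_on_bounded_linear[OF bounded_linear_minus[OF bounded_linear_ident]]
        Ck_on_bounded_bilinear[OF bounded_bilinear_matrix_mult] f g)+
  ultimately show ?case
    unfolding Ck_on.simps
    by (intro exI[of _ "\<lambda>z. - (?g z ** fx z ** ?g z)"] exI[of _ "\<lambda>z. - (?g z ** fy z ** ?g z)"]
        conjI ballI)
qed

lemma smooth_map_on_imp_differentiable:
  "smooth_map_on U f \<Longrightarrow> z \<in> U \<Longrightarrow> f differentiable at z"
  unfolding smooth_map_on_def using Ck_on_differentiable by blast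

lemma smooth_map_on_cong:
  "open U \<Longrightarrow> (\<And>z. z \<in> U \<Longrightarrow> f z = g z) \<Longrightarrow> smooth_map_on U f \<Longrightarrow> smooth_map_on U g"
  unfolding smooth_map_on_def using Ck_on_cong by blast

lemma smooth_map_on_dx: "open U \<Longrightarrow> smooth_map_on U f \<Longrightarrow> smooth_map_on U (dx f)"
  and smooth_map_on_dy: "open U \<Longrightarrow> smooth_map_on U f \<Longrightarrow> smooth_map_on U (dy f)"
  unfolding smooth_map_on_def using Ck_on_Suc_iff by blast+

lemma smooth_map_on_matrix_mult:
  fixes f g :: "complex \<Rightarrow> 'n::finite cmat"
  shows "smooth_map_on U f \<Longrightarrow> smooth_map_on U g \<Longrightarrow> smooth_map_on U (\<lambda>z. f z ** g z)"
  unfolding smooth_map_on_def using Ck_on_bounded_bilinear[OF bounded_bilinear_matrix_mult] by blast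

lemma smooth_map_on_matrix_inv:
  fixes f :: "complex \<Rightarrow> 'n::finite cmat"
  shows "open U \<Longrightarrow> (\<And>z. z \<in> U \<Longrightarrow> invertible (f z)) \<Longrightarrow> smooth_map_on U f \<Longrightarrow>
    smooth_map_on U (\<lambda>z. matrix_inv (f z))"
  unfolding smooth_map_on_def using Ck_on_matrix_inv by blast

text \<open>The second difference is a difference in the direction \<open>b\<close> of differences in the direction \<open>a\<close>, and
  the mean value theorem applies to one after the other. As its left-hand side is symmetric in \<open>a\<close> and
  \<open>b\<close>, this is the source of the symmetry of second derivatives.\<close>

lemma second_difference_mean_value:
  fixes g :: "complex \<Rightarrow> real"
  assumes g: "\<And>p. p \<in> ball z r \<Longrightarrow> (g has_derivative Dg p) (at p)"
    and ga: "\<And>p. p \<in> ball z r \<Longrightarrow> ((\<lambda>q. Dg q a) has_derivative Da p) (at p)"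
    and ab: "norm a = 1" "norm b = 1" and h: "0 < h" "2 * h < r"
  obtains p where "dist z p \<le> 2 * h"
    "g (z + h *\<^sub>R a + h *\<^sub>R b) - g (z + h *\<^sub>R a) - g (z + h *\<^sub>R b) + g z = h\<^sup>2 * Da p b"
proof -
  have near: "dist z (z + s *\<^sub>R a + t *\<^sub>R b) \<le> 2 * h" if "0 \<le> s" "s \<le> h" "0 \<le> t" "t \<le> h" for s t
  proof -
    have "norm (s *\<^sub>R a + t *\<^sub>R b) \<le> norm (s *\<^sub>R a) + norm (t *\<^sub>R b)"
      by (rule norm_triangle_ineq)
    moreover have "dist z (z + s *\<^sub>R a + t *\<^sub>R b) = norm (s *\<^sub>R a + t *\<^sub>R b)"
      using norm_minus_cancel[of "s *\<^sub>R a + t *\<^sub>R b"]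
      by (simp add: dist_norm del: norm_minus_cancel)
    ultimately show ?thesis
      using that ab by simp
  qed
  have near': "z + s *\<^sub>R a + t *\<^sub>R b \<in> ball z r" if "0 \<le> s" "s \<le> h" "0 \<le> t" "t \<le> h" for s t
    using near[OF that] h by simp
  have line: "((\<lambda>s. f (q + s *\<^sub>R v)) has_real_derivative D v) (at s)"
    if "(f has_derivative D) (at (q + s *\<^sub>R v))" for f :: "complex \<Rightarrow> real" and q v D s
  proof -
    have "((\<lambda>s. q + s *\<^sub>R v) has_derivative (\<lambda>d. d *\<^sub>R v)) (at s)"
      by (auto intro!: derivative_eq_intros)
    from has_derivative_compose[OF this that]
    have "((\<lambda>s. f (q + s *\<^sub>R v)) has_derivative (\<lambda>d. D (d *\<^sub>R v))) (at s)" .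
    moreover have "D (d *\<^sub>R v) = D v * d" for d
      using has_derivative_linear[OF that] by (simp add: linear_scale)
    ultimately show ?thesis
      by (simp add: has_field_derivative_def)
  qed
  (* first the direction a, for the difference u in the direction b *)
  define u where "u s = g (z + h *\<^sub>R b + s *\<^sub>R a) - g (z + s *\<^sub>R a)" for s
  have "(u has_real_derivative Dg (z + h *\<^sub>R b + s *\<^sub>R a) a - Dg (z + s *\<^sub>R a) a) (at s)"
    if "0 \<le> s" "s \<le> h" for s
    unfolding u_def using near'[OF that, of h] near'[OF that, of 0] h
    by (intro DERIV_diff line g) (simp_all add: algebra_simps)
  from MVT2[OF h(1) this] obtain s where s: "0 < s" "s < h"
    "u h - u 0 = h * (Dg (z + h *\<^sub>R b + s *\<^sub>R a) a - Dg (z + s *\<^sub>R a) a)"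
    by auto
  define v where "v t = Dg (z + s *\<^sub>R a + t *\<^sub>R b) a" for t
  have "(v has_real_derivative Da (z + s *\<^sub>R a + t *\<^sub>R b) b) (at t)" if "0 \<le> t" "t \<le> h" for t
    unfolding v_def using near'[OF _ _ that, of s] s by (intro line ga) auto
  from MVT2[OF h(1) this] obtain t where t: "0 < t" "t < h"
    "v h - v 0 = h * Da (z + s *\<^sub>R a + t *\<^sub>R b) b"
    by auto
  show ?thesis
  proof
    show "dist z (z + s *\<^sub>R a + t *\<^sub>R b) \<le> 2 * h"
      using near s t by simp
    show "g (z + h *\<^sub>R a + h *\<^sub>R b) - g (z + h *\<^sub>R a) - g (z + h *\<^sub>R b) + g z
        = h\<^sup>2 * Da (z + s *\<^sub>R a + t *\<^sub>R b) b"
      using s(3) t(3) by (simp add: u_def v_def power2_eq_square algebra_simps)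
  qed
qed

lemma dx_dy_inner:
  fixes f :: "complex \<Rightarrow> 'b::euclidean_space"
  assumes "f differentiable at z"
  shows "dx (\<lambda>p. f p \<bullet> c) z = dx f z \<bullet> c" "dy (\<lambda>p. f p \<bullet> c) z = dy f z \<bullet> c"
  using dx_dy_eqI[OF has_derivative_inner_left[OF has_derivative_dx_dy[OF assms]], of c] by auto

text \<open>Evaluating the second difference in both orders gives points \<open>p\<close> and \<open>q\<close> near \<open>z\<close> with equal mixed
  derivatives, which are close to those at \<open>z\<close> by continuity.\<close>

lemma dx_dy_commute_real:
  fixes g :: "complex \<Rightarrow> real"
  assumes U: "open U" "z \<in> U" and g: "Ck_on 2 U g"
  shows "dx (dy g) z = dy (dx g) z"
proof -
  have diff: "g differentiable at p" "dx g differentiable at p" "dy g differentiable at p"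
    if "p \<in> U" for p
    using g that U by (auto simp: numeral_2_eq_2 Ck_on_Suc_iff simp del: Ck_on.simps)
  have cont: "continuous_on U (dx (dy g))" "continuous_on U (dy (dx g))"
    using g U by (auto simp: numeral_2_eq_2 Ck_on_Suc_iff simp del: Ck_on.simps)
       (auto intro: Ck_on_imp_continuous_on)
  obtain r where r: "r > 0" "ball z r \<subseteq> U"
    using U openE by blast
  note D = has_derivative_dx_dy
  have "\<bar>dx (dy g) z - dy (dx g) z\<bar> \<le> e" if "e > 0" for e
  proof -
    have "isCont (dx (dy g)) z" "isCont (dy (dx g)) z"
      using cont U continuous_on_eq_continuous_at by auto
    then obtain d1 d2 where d: "d1 > 0" "d2 > 0"
      "\<And>p. dist p z < d1 \<Longrightarrow> dist (dx (dy g) p) (dx (dy g) z) < e / 2"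
      "\<And>p. dist p z < d2 \<Longrightarrow> dist (dy (dx g) p) (dy (dx g) z) < e / 2"
      using \<open>e > 0\<close> unfolding continuous_at by (metis continuous_at continuous_at_eps_delta half_gt_zero)
    define h where "h = min (min d1 d2) r / 3"
    have h: "h > 0" "2 * h < r" "2 * h < d1" "2 * h < d2"
      using d r by (auto simp: h_def min_def)
    have Dg: "(g has_derivative (\<lambda>v. Re v *\<^sub>R dx g p + Im v *\<^sub>R dy g p)) (at p)"
      if "p \<in> ball z r" for p
      using r that diff by (intro D) auto
    have Dx: "((\<lambda>q. Re 1 *\<^sub>R dx g q + Im 1 *\<^sub>R dy g q) has_derivative
        (\<lambda>v. Re v *\<^sub>R dx (dx g) p + Im v *\<^sub>R dy (dx g) p)) (at p)" if "p \<in> ball z r" for p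
      using D[of "dx g" p] r that diff by auto
    have Dy: "((\<lambda>q. Re \<i> *\<^sub>R dx g q + Im \<i> *\<^sub>R dy g q) has_derivative
        (\<lambda>v. Re v *\<^sub>R dx (dy g) p + Im v *\<^sub>R dy (dy g) p)) (at p)" if "p \<in> ball z r" for p
      using D[of "dy g" p] r that diff by auto
    obtain p where p: "dist z p \<le> 2 * h"
      "g (z + h *\<^sub>R 1 + h *\<^sub>R \<i>) - g (z + h *\<^sub>R 1) - g (z + h *\<^sub>R \<i>) + g z =
        h\<^sup>2 * (Re \<i> *\<^sub>R dx (dx g) p + Im \<i> *\<^sub>R dy (dx g) p)"
      by (rule second_difference_mean_value[where r = r and b = \<i> and h = h, OF Dg Dx]) (use h in auto)
    obtain q where q: "dist z q \<le> 2 * h"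
      "g (z + h *\<^sub>R \<i> + h *\<^sub>R 1) - g (z + h *\<^sub>R \<i>) - g (z + h *\<^sub>R 1) + g z =
        h\<^sup>2 * (Re 1 *\<^sub>R dx (dy g) q + Im 1 *\<^sub>R dy (dy g) q)"
      by (rule second_difference_mean_value[where r = r and b = 1 and h = h, OF Dg Dy]) (use h in auto)
    have "h\<^sup>2 * dy (dx g) p = h\<^sup>2 * dx (dy g) q"
      using p(2) q(2) by (simp add: algebra_simps)
    then have "dy (dx g) p = dx (dy g) q"
      using h by simp
    moreover have "dist (dx (dy g) q) (dx (dy g) z) < e / 2" "dist (dy (dx g) p) (dy (dx g) z) < e / 2"
      using d(3)[of q] d(4)[of p] p q h by (auto simp: dist_commute)
    ultimately show ?thesis
      unfolding dist_real_def by linarith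
  qed
  then show ?thesis
    using field_le_epsilon[of "\<bar>dx (dy g) z - dy (dx g) z\<bar>" 0] by auto
qed

lemma dx_dy_commute:
  fixes f :: "complex \<Rightarrow> 'b::euclidean_space"
  assumes U: "open U" "z \<in> U" and f: "smooth_map_on U f"
  shows "dx (dy f) z = dy (dx f) z"
proof (rule euclidean_eqI)
  fix c :: 'b
  let ?g = "\<lambda>p. f p \<bullet> c"
  note diff = smooth_map_on_imp_differentiable[OF f]
    smooth_map_on_imp_differentiable[OF smooth_map_on_dx[OF U(1) f]]
    smooth_map_on_imp_differentiable[OF smooth_map_on_dy[OF U(1) f]]
  have *: "dx f p \<bullet> c = dx ?g p" "dy f p \<bullet> c = dy ?g p" if "p \<in> U" for p
    by (simp_all add: dx_dy_inner diff(1) that)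
  have "dx (dy f) z \<bullet> c = dx (\<lambda>p. dy f p \<bullet> c) z"
    by (simp add: dx_dy_inner diff U)
  also have "\<dots> = dx (dy ?g) z"
    by (rule dx_dy_cong[OF U *(2)]) (use diff U in \<open>auto intro!: differentiable_inner\<close>)
  also have "\<dots> = dy (dx ?g) z"
  proof (rule dx_dy_commute_real[OF U])
    show "Ck_on 2 U ?g"
      by (rule Ck_on_bounded_linear[OF bounded_linear_inner_left]) (use f in \<open>simp add: smooth_map_on_def\<close>)
  qed
  also have "\<dots> = dy (\<lambda>p. dx f p \<bullet> c) z"
    by (rule dx_dy_cong[OF U *(1), symmetric]) (use diff U in \<open>auto intro!: differentiable_inner\<close>)
  also have "\<dots> = dy (dx f) z \<bullet> c"
    by (simp add: dx_dy_inner diff U)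
  finally show "dx (dy f) z \<bullet> c = dy (dx f) z \<bullet> c" .
qed

section \<open>Loops in the weighted Wiener algebra\<close>

lemma admissible_weight_ge_1: "admissible_weight w \<Longrightarrow> 1 \<le> w n"
  by (simp add: admissible_weight_def)

lemma wiener_loop_coeff_summable:
  assumes w: "admissible_weight w" and \<gamma>: "wiener_loop w \<gamma>"
  shows "(\<lambda>n. norm (fourier_coeff \<gamma> n)) summable_on UNIV"
proof (rule summable_on_comparison_test)
  show "(\<lambda>n. w n * norm (fourier_coeff \<gamma> n)) summable_on UNIV"
    using \<gamma> by (simp add: wiener_loop_def)
  show "norm (fourier_coeff \<gamma> n) \<le> w n * norm (fourier_coeff \<gamma> n)" for n
    using mult_right_mono[OF admissible_weight_ge_1[OF w, of n], of "norm (fourier_coeff \<gamma> n)"] by simp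
qed simp

text \<open>Since the weight is at least \<open>1\<close>, the weighted norm dominates the sum of the norms of the Fourier
  coefficients.\<close>

lemma norm_wiener_loop_le:
  assumes w: "admissible_weight w" and \<gamma>: "wiener_loop w \<gamma>" and l: "l \<in> sphere 0 1"
  shows "norm (\<gamma> l) \<le> wiener_norm w \<gamma>"
proof -
  have nrm: "norm ((l powi n) *\<^sub>m fourier_coeff \<gamma> n) = norm (fourier_coeff \<gamma> n)" for n
    using l by (simp add: norm_cscale norm_power_int)
  have sum: "((\<lambda>n. norm ((l powi n) *\<^sub>m fourier_coeff \<gamma> n))
      has_sum (\<Sum>\<^sub>\<infinity>n. norm (fourier_coeff \<gamma> n))) UNIV"
    unfolding nrm using wiener_loop_coeff_summable[OF w \<gamma>] by (rule has_sum_infsum)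
  have "((\<lambda>n. l powi n *\<^sub>m fourier_coeff \<gamma> n) has_sum \<gamma> l) UNIV"
    using \<gamma> l by (simp add: wiener_loop_def)
  with sum have "norm (\<gamma> l) \<le> (\<Sum>\<^sub>\<infinity>n. norm (fourier_coeff \<gamma> n))"
    by (rule norm_has_sum_bound)
  also have "\<dots> \<le> wiener_norm w \<gamma>"
    unfolding wiener_norm_def
  proof (rule infsum_mono)
    show "(\<lambda>n. w n * norm (fourier_coeff \<gamma> n)) summable_on UNIV"
      using \<gamma> by (simp add: wiener_loop_def)
    show "norm (fourier_coeff \<gamma> n) \<le> w n * norm (fourier_coeff \<gamma> n)" for n
      using mult_right_mono[OF admissible_weight_ge_1[OF w, of n], of "norm (fourier_coeff \<gamma> n)"] by simp
  qed (rule wiener_loop_coeff_summable[OF w \<gamma>])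
  finally show ?thesis .
qed

text \<open>The Fourier series converges uniformly by the Weierstrass test. Continuity makes the integrals
  that define the Fourier coefficients exist, hence additive; this is what the closure of the Wiener
  loops under sums rests on.\<close>

lemma continuous_on_wiener_loop:
  fixes \<gamma> :: "complex \<Rightarrow> 'n::finite cmat"
  assumes w: "admissible_weight w" and \<gamma>: "wiener_loop w \<gamma>"
  shows "continuous_on (sphere 0 1) \<gamma>"
proof -
  let ?u = "\<lambda>n l. (l powi n) *\<^sub>m fourier_coeff \<gamma> n"
  have "uniform_limit (sphere 0 1) (\<lambda>X l. \<Sum>n\<in>X. ?u n l) (\<lambda>l. \<Sum>\<^sub>\<infinity>n. ?u n l) (finite_subsets_at_top UNIV)"
    by (rule Weierstrass_m_test_general[OF _ wiener_loop_coeff_summable[OF w \<gamma>]])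
       (simp add: norm_cscale norm_power_int)
  moreover have "(\<Sum>\<^sub>\<infinity>n. ?u n l) = \<gamma> l" if "l \<in> sphere 0 1" for l
    using \<gamma> that by (auto simp: wiener_loop_def intro: infsumI)
  ultimately have lim: "uniform_limit (sphere 0 1) (\<lambda>X l. \<Sum>n\<in>X. ?u n l) \<gamma> (finite_subsets_at_top UNIV)"
    using uniform_limit_cong'[of "sphere 0 1" "\<lambda>X l. \<Sum>n\<in>X. ?u n l" "\<lambda>X l. \<Sum>n\<in>X. ?u n l"
      "\<lambda>l. \<Sum>\<^sub>\<infinity>n. ?u n l" \<gamma>] by simp
  have "continuous_on (sphere 0 1) (\<lambda>l. \<Sum>n\<in>X. ?u n l)" for X
    by (intro continuous_on_sum bounded_bilinear.continuous_on[OF bounded_bilinear_cscale]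
        continuous_on_const continuous_on_power_int continuous_on_id) auto
  then show ?thesis
    by (intro uniform_limit_theorem[OF _ lim]) auto
qed

lemma fourier_integrand_integrable:
  fixes \<gamma> :: "complex \<Rightarrow> 'n::finite cmat"
  assumes "continuous_on (sphere 0 1) \<gamma>"
  shows "(\<lambda>t. cis (- (of_int n * t)) *\<^sub>m \<gamma> (cis t)) integrable_on {0..2 * pi}"
proof (rule integrable_continuous_interval)
  have "continuous_on {0..2 * pi} (\<lambda>t. \<gamma> (cis t))"
    by (rule continuous_on_compose2[OF assms]) (auto intro: continuous_intros)
  then show "continuous_on {0..2 * pi} (\<lambda>t. cis (- (of_int n * t)) *\<^sub>m \<gamma> (cis t))"
    by (intro bounded_bilinear.continuous_on[OF bounded_bilinear_cscale] continuous_intros)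
qed

lemma fourier_coeff_add:
  assumes "continuous_on (sphere 0 1) \<gamma>" "continuous_on (sphere 0 1) \<delta>"
  shows "fourier_coeff (\<lambda>l. \<gamma> l + \<delta> l) n = fourier_coeff \<gamma> n + fourier_coeff \<delta> n"
  using assms[THEN fourier_integrand_integrable[where n = n]]
  by (simp add: fourier_coeff_def cscale.add_right integral_add scaleR_right_distrib)

lemma fourier_coeff_scaleR:
  "fourier_coeff (\<lambda>l. r *\<^sub>R \<gamma> l) n = r *\<^sub>R fourier_coeff \<gamma> n"
  by (simp add: fourier_coeff_def cscale.scaleR_right)

lemma wiener_loop_add:
  assumes w: "admissible_weight w" and "wiener_loop w \<gamma>" "wiener_loop w \<delta>"
  shows "wiener_loop w (\<lambda>l. \<gamma> l + \<delta> l)"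
proof -
  have coeff: "fourier_coeff (\<lambda>l. \<gamma> l + \<delta> l) n = fourier_coeff \<gamma> n + fourier_coeff \<delta> n" for n
    by (intro fourier_coeff_add continuous_on_wiener_loop[OF w] assms(2,3))
  have "(\<lambda>n. w n * norm (fourier_coeff \<gamma> n + fourier_coeff \<delta> n)) summable_on UNIV"
  proof (rule summable_on_comparison_test)
    show "(\<lambda>n. w n * norm (fourier_coeff \<gamma> n) + w n * norm (fourier_coeff \<delta> n)) summable_on UNIV"
      using assms by (intro summable_on_add) (simp_all add: wiener_loop_def)
    fix n
    have "0 \<le> w n"
      using admissible_weight_ge_1[OF w, of n] by simp
    then show "w n * norm (fourier_coeff \<gamma> n + fourier_coeff \<delta> n)
        \<le> w n * norm (fourier_coeff \<gamma> n) + w n * norm (fourier_coeff \<delta> n)"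
      "0 \<le> w n * norm (fourier_coeff \<gamma> n + fourier_coeff \<delta> n)"
      using mult_left_mono[OF norm_triangle_ineq] by (simp_all add: distrib_left)
  qed
  moreover have "((\<lambda>n. l powi n *\<^sub>m (fourier_coeff \<gamma> n + fourier_coeff \<delta> n)) has_sum (\<gamma> l + \<delta> l)) UNIV"
    if "l \<in> sphere 0 1" for l
    unfolding cscale.add_right using assms(2,3) that
    by (intro has_sum_add) (simp_all add: wiener_loop_def)
  ultimately show ?thesis
    unfolding wiener_loop_def coeff by blast
qed

lemma wiener_loop_scaleR:
  assumes "wiener_loop w \<gamma>"
  shows "wiener_loop w (\<lambda>l. r *\<^sub>R \<gamma> l)"
proof -
  have "(\<lambda>n. \<bar>r\<bar> * (w n * norm (fourier_coeff \<gamma> n))) summable_on UNIV"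
    using assms by (intro summable_on_cmult_right) (simp add: wiener_loop_def)
  moreover have "((\<lambda>n. l powi n *\<^sub>m (r *\<^sub>R fourier_coeff \<gamma> n)) has_sum (r *\<^sub>R \<gamma> l)) UNIV"
    if "l \<in> sphere 0 1" for l
    unfolding cscale.scaleR_right using assms that
    by (intro has_sum_scaleR) (simp_all add: wiener_loop_def)
  ultimately show ?thesis
    unfolding wiener_loop_def fourier_coeff_scaleR norm_scaleR mult.left_commute[of "w _"] by blast
qed

lemma wiener_loop_diff:
  assumes "admissible_weight w" "wiener_loop w \<gamma>" "wiener_loop w \<delta>"
  shows "wiener_loop w (\<lambda>l. \<gamma> l - \<delta> l)"
  using wiener_loop_add[OF assms(1,2) wiener_loop_scaleR[OF assms(3), of "-1"]] by simp

lemma loop_Ck_on_imp_wiener_loop: "loop_Ck_on w k U f \<Longrightarrow> z \<in> U \<Longrightarrow> wiener_loop w (f z)"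
  by (cases k) auto

text \<open>The weighted norm dominates the supremum norm on the circle, so a derivative in the Banach
  space of loops is a derivative uniformly in the loop parameter. The remainder has to be recognised as
  a Wiener loop first, since the weighted norm of anything else is a meaningless default value.\<close>

lemma loop_derivative_uniform:
  fixes f :: "complex \<Rightarrow> complex \<Rightarrow> 'n::finite cmat"
  assumes w: "admissible_weight w" and U: "open U" "z \<in> U"
    and f: "\<And>z. z \<in> U \<Longrightarrow> wiener_loop w (f z)" and fxy: "wiener_loop w fx" "wiener_loop w fy"
    and lim: "((\<lambda>h. wiener_norm w (\<lambda>l. f (z + h) l - f z l - (Re h *\<^sub>R fx l + Im h *\<^sub>R fy l))
      / norm h) \<longlongrightarrow> 0) (at 0)"
  shows "uniform_limit (sphere 0 1)
    (\<lambda>h l. (f (z + h) l - f z l - (Re h *\<^sub>R fx l + Im h *\<^sub>R fy l)) /\<^sub>R norm h) (\<lambda>l. 0) (at 0)"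
proof (rule uniform_limitI)
  fix e :: real
  assume "e > 0"
  let ?r = "\<lambda>h l. f (z + h) l - f z l - (Re h *\<^sub>R fx l + Im h *\<^sub>R fy l)"
  have "\<forall>\<^sub>F h in at 0. wiener_norm w (?r h) / norm h < e"
    using lim \<open>e > 0\<close> by (rule order_tendstoD)
  moreover have "\<forall>\<^sub>F h in at 0. z + h \<in> U"
  proof -
    have "((\<lambda>h. z + h) \<longlongrightarrow> z + 0) (at 0)"
      by (intro tendsto_intros)
    with U show ?thesis
      by (auto dest: topological_tendstoD)
  qed
  ultimately show "\<forall>\<^sub>F h in at 0. \<forall>l\<in>sphere 0 1. dist (?r h l /\<^sub>R norm h) 0 < e"
  proof eventually_elim
    case (elim h)
    show ?case
    proof
      fix l :: complex
      assume "l \<in> sphere 0 1"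
      moreover have "wiener_loop w (?r h)"
        using U elim by (intro wiener_loop_diff wiener_loop_add wiener_loop_scaleR w f fxy)
      ultimately have "norm (?r h l) \<le> wiener_norm w (?r h)"
        using norm_wiener_loop_le[OF w] by blast
      then have "norm (?r h l) / norm h \<le> wiener_norm w (?r h) / norm h"
        by (rule divide_right_mono) simp
      with elim show "dist (?r h l /\<^sub>R norm h) 0 < e"
        by (simp add: divide_inverse mult.commute)
    qed
  qed
qed

lemma has_derivative_of_loop_derivative:
  assumes "uniform_limit (sphere 0 1)
    (\<lambda>h l. (f (z + h) l - f z l - (Re h *\<^sub>R fx l + Im h *\<^sub>R fy l)) /\<^sub>R norm h) (\<lambda>l. 0) (at 0)"
    and "l \<in> sphere 0 1"
  shows "((\<lambda>z. f z l) has_derivative (\<lambda>h. Re h *\<^sub>R fx l + Im h *\<^sub>R fy l)) (at z)"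
proof -
  have "((\<lambda>h. (f (z + h) l - f z l - (Re h *\<^sub>R fx l + Im h *\<^sub>R fy l)) /\<^sub>R norm h) \<longlongrightarrow> 0) (at 0)"
    using assms by (rule tendsto_uniform_limitI)
  from tendsto_norm_zero[OF this]
  have "((\<lambda>h. norm (f (z + h) l - f z l - (Re h *\<^sub>R fx l + Im h *\<^sub>R fy l)) / norm h) \<longlongrightarrow> 0) (at 0)"
    by (simp add: divide_inverse mult.commute)
  moreover have "bounded_linear (\<lambda>h. Re h *\<^sub>R fx l + Im h *\<^sub>R fy l)"
    by (intro bounded_linear_add bounded_linear_scaleR_const bounded_linear_Re bounded_linear_Im)
  ultimately show ?thesis
    by (simp add: has_derivative_at)
qed

lemma loop_Ck_on_imp_Ck_on:
  fixes f :: "complex \<Rightarrow> complex \<Rightarrow> 'n::finite cmat"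
  assumes w: "admissible_weight w" and U: "open U" and l: "l \<in> sphere 0 1"
  shows "loop_Ck_on w k U f \<Longrightarrow> Ck_on k U (\<lambda>z. f z l)"
proof (induction k arbitrary: f)
  case 0
  have "((\<lambda>\<zeta>. f \<zeta> l) \<longlongrightarrow> f z l) (at z)" if z: "z \<in> U" for z
  proof -
    have "((\<lambda>\<zeta>. wiener_norm w (\<lambda>l. f \<zeta> l - f z l)) \<longlongrightarrow> 0) (at z)"
      using 0 z by simp
    moreover have "\<forall>\<^sub>F \<zeta> in at z. norm (f \<zeta> l - f z l) \<le> wiener_norm w (\<lambda>l. f \<zeta> l - f z l)"
      using eventually_at_in_open'[OF U z]
    proof eventually_elim
      case (elim \<zeta>)
      with 0 z have "wiener_loop w (\<lambda>l. f \<zeta> l - f z l)"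
        by (intro wiener_loop_diff w) auto
      then show ?case
        by (rule norm_wiener_loop_le[OF w _ l])
    qed
    ultimately have "((\<lambda>\<zeta>. f \<zeta> l - f z l) \<longlongrightarrow> 0) (at z)"
      by (rule Lim_null_comparison[rotated])
    then show ?thesis
      by (simp add: LIM_zero_iff)
  qed
  then show ?case
    by (auto simp: continuous_on_eq_continuous_at[OF U] isCont_def)
next
  case (Suc k)
  then have f0: "\<And>z. z \<in> U \<Longrightarrow> wiener_loop w (f z)"
    by simp
  from Suc.prems obtain fx fy where f:
    "\<And>z. z \<in> U \<Longrightarrow> ((\<lambda>h. wiener_norm w (\<lambda>l. f (z + h) l - f z l
      - (Re h *\<^sub>R fx z l + Im h *\<^sub>R fy z l)) / norm h) \<longlongrightarrow> 0) (at 0)"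
    "loop_Ck_on w k U fx" "loop_Ck_on w k U fy"
    unfolding loop_Ck_on.simps by blast
  have *: "((\<lambda>z. f z l) has_derivative (\<lambda>h. Re h *\<^sub>R fx z l + Im h *\<^sub>R fy z l)) (at z)" if z: "z \<in> U" for z
    by (rule has_derivative_of_loop_derivative[OF loop_derivative_uniform[OF w U z f0 _ _ f(1)[OF z]] l])
       (use f(2,3) z loop_Ck_on_imp_wiener_loop in blast)+
  show ?case
    unfolding Ck_on.simps
    by (intro exI[of _ "\<lambda>z. fx z l"] exI[of _ "\<lambda>z. fy z l"] conjI ballI * Suc.IH f(2,3))
qed

lemma smooth_loop_map_on_imp_smooth_map_on:
  fixes f :: "complex \<Rightarrow> complex \<Rightarrow> 'n::finite cmat"
  assumes "admissible_weight w" "open U" "l \<in> sphere 0 1" "smooth_loop_map_on w U f"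
  shows "smooth_map_on U (\<lambda>z. f z l)"
  unfolding smooth_map_on_def
proof
  show "Ck_on k U (\<lambda>z. f z l)" for k
    using assms(4) by (intro loop_Ck_on_imp_Ck_on[OF assms(1-3)]) (simp add: smooth_loop_map_on_def)
qed

section \<open>Boundary values of holomorphic functions on the disk\<close>

text \<open>A variant of \<open>extends_to_disk\<close> with the extension as an argument, because its value at \<open>0\<close> is
  needed.\<close>

definition disk_extension :: "(complex \<Rightarrow> 'n::finite cmat) \<Rightarrow> (complex \<Rightarrow> 'n cmat) \<Rightarrow> bool"
  where "disk_extension f h \<longleftrightarrow> continuous_on (cball 0 1) h \<and>
    (\<forall>i j. (\<lambda>l. h l $ i $ j) holomorphic_on ball 0 1) \<and> (\<forall>l\<in>sphere 0 1. h l = f l)"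

lemma extends_to_disk_iff: "extends_to_disk f \<longleftrightarrow> (\<exists>h. disk_extension f h)"
  by (simp add: extends_to_disk_def disk_extension_def)

lemma disk_extensionI:
  assumes "continuous_on (cball 0 1) h" "\<And>i j. (\<lambda>l. h l $ i $ j) holomorphic_on ball 0 1"
    and "\<And>l. l \<in> sphere 0 1 \<Longrightarrow> h l = f l"
  shows "disk_extension f h"
  using assms unfolding disk_extension_def by blast

lemma disk_extensionD:
  assumes "disk_extension f h"
  shows "continuous_on (cball 0 1) h" "(\<lambda>l. h l $ i $ j) holomorphic_on ball 0 1"
    "l \<in> sphere 0 1 \<Longrightarrow> h l = f l"
  using assms unfolding disk_extension_def by blast+

text \<open>By the maximum principle, extensions of uniformly convergent boundary values converge
  uniformly on the closed disk.\<close>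

lemma extends_to_disk_uniform_limit:
  fixes f :: "nat \<Rightarrow> complex \<Rightarrow> 'n::finite cmat"
  assumes ext: "\<And>k. extends_to_disk (f k)" and lim: "uniform_limit (sphere 0 1) f g sequentially"
  shows "extends_to_disk g"
proof -
  define H where "H k = (SOME h. disk_extension (f k) h)" for k
  have "disk_extension (f k) (H k)" for k
    using ext[of k] unfolding H_def extends_to_disk_iff by (rule someI_ex)
  note H = this[THEN disk_extensionD(1)] this[THEN disk_extensionD(2)] this[THEN disk_extensionD(3)]
  have cont: "continuous_on (cball 0 1) (\<lambda>l. H k l $ i $ j)" for k i j
    by (intro bounded_linear.continuous_on[OF bounded_linear_entry] H)
  have "\<exists>a. uniform_limit (cball 0 1) (\<lambda>k l. H k l $ i $ j) a sequentially" for i j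
  proof -
    have "uniformly_Cauchy_on (cball 0 1) (\<lambda>k l. H k l $ i $ j)"
      unfolding uniformly_Cauchy_on_def
    proof (intro allI impI)
      fix e :: real
      assume "e > 0"
      have "uniformly_Cauchy_on (sphere 0 1) f"
        using lim by (intro uniformly_convergent_Cauchy) (auto simp: uniformly_convergent_on_def)
      with \<open>e > 0\<close> obtain M where M: "\<And>l m n. l \<in> sphere 0 1 \<Longrightarrow> m \<ge> M \<Longrightarrow> n \<ge> M \<Longrightarrow>
          dist (f m l) (f n l) < e / 2"
        unfolding uniformly_Cauchy_on_def by (meson half_gt_zero)
      have "dist (H m l $ i $ j) (H n l $ i $ j) < e" if "l \<in> cball 0 1" "m \<ge> M" "n \<ge> M" for l m n
      proof -
        have "norm (H m l $ i $ j - H n l $ i $ j) \<le> e / 2"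
        proof (rule maximum_modulus_frontier[where S = "cball 0 1" and f = "\<lambda>l. H m l $ i $ j - H n l $ i $ j"])
          show "(\<lambda>l. H m l $ i $ j - H n l $ i $ j) holomorphic_on interior (cball 0 1)"
            by (simp add: interior_cball holomorphic_on_diff H)
          show "continuous_on (closure (cball 0 1)) (\<lambda>l. H m l $ i $ j - H n l $ i $ j)"
            by (simp add: continuous_on_diff cont)
          fix u :: complex
          assume "u \<in> frontier (cball 0 1)"
          then have u: "u \<in> sphere 0 1"
            by simp
          have "norm ((f m u - f n u) $ i $ j) \<le> norm (f m u - f n u)"
            by (meson Finite_Cartesian_Product.norm_nth_le order_trans)
          also have "\<dots> \<le> e / 2"
            using M[OF u that(2,3)] by (simp add: dist_norm)
          finally show "norm (H m u $ i $ j - H n u $ i $ j) \<le> e / 2"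
            using u by (simp add: H)
        qed (use that in auto)
        with \<open>e > 0\<close> show ?thesis
          by (simp add: dist_norm)
      qed
      then show "\<exists>M. \<forall>l\<in>cball 0 1. \<forall>m\<ge>M. \<forall>n\<ge>M. dist (H m l $ i $ j) (H n l $ i $ j) < e"
        by blast
    qed
    then show ?thesis
      using Cauchy_uniformly_convergent uniformly_convergent_on_def by blast
  qed
  then obtain a where a: "\<And>i j. uniform_limit (cball 0 1) (\<lambda>k l. H k l $ i $ j) (a i j) sequentially"
    by metis
  have "continuous_on (cball 0 1) (a i j)" "a i j holomorphic_on ball 0 1" for i j
    using holomorphic_uniform_limit[OF _ a[of i j]] cont H(2) by auto
  moreover have "g l $ i $ j = a i j l" if l: "l \<in> sphere 0 1" for l i j
  proof (rule LIMSEQ_unique)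
    show "(\<lambda>k. H k l $ i $ j) \<longlonglongrightarrow> a i j l"
      by (rule tendsto_uniform_limitI[OF a]) (use l in auto)
    have "(\<lambda>k. f k l) \<longlonglongrightarrow> g l"
      using lim l by (rule tendsto_uniform_limitI)
    then show "(\<lambda>k. H k l $ i $ j) \<longlonglongrightarrow> g l $ i $ j"
      using l by (auto simp: H intro!: tendsto_vec_nth)
  qed
  ultimately have "disk_extension g (\<lambda>l. \<chi> i j. a i j l)"
    by (intro disk_extensionI) (auto simp: vec_eq_iff intro!: continuous_on_vec_lambda)
  then show ?thesis
    unfolding extends_to_disk_iff by blast
qed

lemma disk_extension_diff:
  assumes "disk_extension f f'" "disk_extension g g'"
  shows "disk_extension (\<lambda>l. f l - g l) (\<lambda>l. f' l - g' l)"
  using assms[THEN disk_extensionD(1)] assms[THEN disk_extensionD(2)] assms[THEN disk_extensionD(3)]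
  by (intro disk_extensionI) (auto intro!: continuous_intros holomorphic_intros)

lemma disk_extension_cscale:
  assumes "disk_extension f f'" and c: "continuous_on (cball 0 1) c" "c holomorphic_on ball 0 1"
  shows "disk_extension (\<lambda>l. c l *\<^sub>m f l) (\<lambda>l. c l *\<^sub>m f' l)"
  using disk_extensionD[OF assms(1)] c
  by (intro disk_extensionI bounded_bilinear.continuous_on[OF bounded_bilinear_cscale])
     (auto intro!: holomorphic_intros)

lemma disk_extension_mult:
  assumes "disk_extension f f'" "disk_extension g g'"
  shows "disk_extension (\<lambda>l. f l ** g l) (\<lambda>l. f' l ** g' l)"
  using assms[THEN disk_extensionD(1)] assms[THEN disk_extensionD(2)] assms[THEN disk_extensionD(3)]
  by (intro disk_extensionI bounded_bilinear.continuous_on[OF bounded_bilinear_matrix_mult])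
     (auto simp: matrix_matrix_mult_def intro!: holomorphic_intros)

lemma disk_extension_const: "disk_extension (\<lambda>l. A) (\<lambda>l. A)"
  by (intro disk_extensionI) auto

lemma disk_extension_cong:
  "disk_extension f h \<Longrightarrow> (\<And>l. l \<in> sphere 0 1 \<Longrightarrow> f l = g l) \<Longrightarrow> disk_extension g h"
  unfolding disk_extension_def by auto

text \<open>A derivative is a uniform limit of difference quotients, and these extend to the disk.\<close>

lemma extends_to_disk_derivative:
  fixes f :: "complex \<Rightarrow> complex \<Rightarrow> 'n::finite cmat"
  assumes U: "open U" "z \<in> U" and ext: "\<And>z. z \<in> U \<Longrightarrow> extends_to_disk (f z)"
    and lim: "uniform_limit (sphere 0 1)
      (\<lambda>h l. (f (z + h) l - f z l - (Re h *\<^sub>R fx l + Im h *\<^sub>R fy l)) /\<^sub>R norm h) (\<lambda>l. 0) (at 0)"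
  shows "extends_to_disk (\<lambda>l. Re h *\<^sub>R fx l + Im h *\<^sub>R fy l)"
proof (cases "h = 0")
  case True
  then show ?thesis
    using disk_extension_const[of 0] by (auto simp: extends_to_disk_iff)
next
  case False
  obtain r where r: "r > 0" "ball z r \<subseteq> U"
    using U openE by blast
  (* step sizes that tend to 0 and keep z + s k * h in the ball *)
  define s where "s k = r / ((2 + real k) * norm h)" for k
  have s: "s k > 0" "z + of_real (s k) * h \<in> U" for k
  proof -
    show "s k > 0"
      using r False by (simp add: s_def)
    then have "dist z (z + of_real (s k) * h) = s k * norm h"
      by (simp add: dist_norm norm_mult)
    also have "\<dots> = r / (2 + real k)"
      using False by (simp add: s_def)
    also have "\<dots> < r"
      using r by (simp add: divide_less_eq)
    finally show "z + of_real (s k) * h \<in> U"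
      using r by auto
  qed
  have lim_s: "s \<longlonglongrightarrow> 0"
  proof -
    have "(\<lambda>k. (r / norm h) / real (k + 2)) \<longlonglongrightarrow> 0"
      by (intro LIMSEQ_ignore_initial_segment lim_const_over_n)
    then show ?thesis
      by (simp add: s_def[abs_def] add.commute mult.commute)
  qed
  have seq: "filterlim (\<lambda>k. of_real (s k) * h) (at 0) sequentially"
    unfolding filterlim_at
  proof (intro conjI)
    show "(\<lambda>k. of_real (s k) * h) \<longlonglongrightarrow> 0"
      using tendsto_mult_right[OF tendsto_of_real[OF lim_s], of h] by simp
    show "\<forall>\<^sub>F k in sequentially. of_real (s k) * h \<in> UNIV \<and> of_real (s k) * h \<noteq> 0"
      using s(1) False by (auto simp: less_imp_neq[symmetric])
  qed
  let ?q = "\<lambda>k l. of_real (1 / s k) *\<^sub>m (f (z + of_real (s k) * h) l - f z l)"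
  show ?thesis
  proof (rule extends_to_disk_uniform_limit)
    show "extends_to_disk (?q k)" for k
    proof -
      obtain a b where "disk_extension (f (z + of_real (s k) * h)) a" "disk_extension (f z) b"
        using ext[OF s(2)] ext[OF U(2)] unfolding extends_to_disk_iff by blast
      from disk_extension_cscale[OF disk_extension_diff[OF this], of "\<lambda>l. of_real (1 / s k)"]
      show ?thesis
        unfolding extends_to_disk_iff by auto
    qed
    let ?rem = "\<lambda>h l. (f (z + h) l - f z l - (Re h *\<^sub>R fx l + Im h *\<^sub>R fy l)) /\<^sub>R norm h"
    have "uniform_limit (sphere 0 1) (\<lambda>k. ?rem (of_real (s k) * h)) (\<lambda>l. 0) sequentially"
      using filterlim_compose[OF lim seq] .
    then have "uniform_limit (sphere 0 1)
        (\<lambda>k l. norm h *\<^sub>R ?rem (of_real (s k) * h) l + (Re h *\<^sub>R fx l + Im h *\<^sub>R fy l))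
        (\<lambda>l. norm h *\<^sub>R 0 + (Re h *\<^sub>R fx l + Im h *\<^sub>R fy l)) sequentially"
      by (intro uniform_limit_add uniform_limit_const
          bounded_linear.uniform_limit[OF bounded_linear_scaleR_right])
    moreover have "norm h *\<^sub>R ?rem (of_real (s k) * h) l + (Re h *\<^sub>R fx l + Im h *\<^sub>R fy l) = ?q k l" for k l
    proof -
      let ?v = "Re h *\<^sub>R fx l + Im h *\<^sub>R fy l" and ?d = "f (z + of_real (s k) * h) l - f z l"
      have v: "Re (of_real (s k) * h) *\<^sub>R fx l + Im (of_real (s k) * h) *\<^sub>R fy l = s k *\<^sub>R ?v"
        by (simp add: scaleR_right_distrib)
      have n: "norm (of_real (s k) * h) = s k * norm h"
        using s(1)[of k] by (simp add: norm_mult)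
      have "norm h *\<^sub>R ?rem (of_real (s k) * h) l = (norm h * inverse (s k * norm h)) *\<^sub>R (?d - s k *\<^sub>R ?v)"
        unfolding v n by (simp only: scaleR_scaleR)
      also have "norm h * inverse (s k * norm h) = 1 / s k"
        using False by (simp add: divide_inverse)
      also have "(1 / s k) *\<^sub>R (?d - s k *\<^sub>R ?v) = (1 / s k) *\<^sub>R ?d - ?v"
        using s(1)[of k] by (simp add: scaleR_right_diff_distrib[of _ ?d])
      finally show ?thesis
        by (simp only: cscale_of_real) simp
    qed
    ultimately show "uniform_limit (sphere 0 1) ?q (\<lambda>l. Re h *\<^sub>R fx l + Im h *\<^sub>R fy l) sequentially"
      by simp
  qed
qed

text \<open>Cauchy's theorem and Cauchy's formulas require no more than continuity up to the circle. They
  say that the Fourier coefficients of the boundary values are the Taylor coefficients at \<open>0\<close>, with none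
  of negative index.\<close>

lemma has_integral_boundary_moment:
  fixes f :: "complex \<Rightarrow> complex"
  assumes f: "continuous_on (cball 0 1) f" "f holomorphic_on ball 0 1"
  shows "((\<lambda>t. cis ((real k + 1) * t) * f (cis t)) has_integral 0) {0..2 * pi}"
    and "((\<lambda>t. cis (- (real k * t)) * f (cis t)) has_integral
      2 * pi / fact k * (deriv ^^ k) f 0) {0..2 * pi}"
proof -
  have pw: "cis t ^ m = cis (real m * t)" for t m
    by (simp add: Complex.DeMoivre)
  have cis_Suc: "cis ((real k + 1) * t) = cis t ^ k * cis t" for t
    by (simp add: pw cis_mult distrib_right)
  have "((\<lambda>u. f u * u ^ k) has_contour_integral 0) (circlepath 0 1)"
  proof (rule Cauchy_theorem_disc[of "{}" 0 1])
    show "(\<lambda>u. f u * u ^ k) field_differentiable at x" if "x \<in> ball 0 1 - {}" for x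
      using that by (intro holomorphic_on_imp_differentiable_at[of _ "ball 0 1"] holomorphic_intros f(2)) auto
  qed (use f in \<open>auto intro!: continuous_intros\<close>)
  then have "((\<lambda>t. f (cis t) * cis t ^ k * \<i> * cis t) has_integral 0) {0..2 * pi}"
    by (simp add: circlepath_def has_contour_integral_part_circlepath_iff)
  from has_integral_mult_right[OF this, of "- \<i>"]
  show "((\<lambda>t. cis ((real k + 1) * t) * f (cis t)) has_integral 0) {0..2 * pi}"
    unfolding cis_Suc by (simp add: mult_ac)
  have "((\<lambda>u. f u / (u - 0) ^ Suc k) has_contour_integral (2 * pi * \<i>) / fact k * (deriv ^^ k) f 0)
      (circlepath 0 1)"
    by (rule Cauchy_has_contour_integral_higher_derivative_circlepath) (use f in auto)
  then have "((\<lambda>t. f (cis t) / cis t ^ Suc k * \<i> * cis t) has_integral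
      (2 * pi * \<i>) / fact k * (deriv ^^ k) f 0) {0..2 * pi}"
    by (simp add: circlepath_def has_contour_integral_part_circlepath_iff)
  from has_integral_mult_right[OF this, of "- \<i>"]
  have *: "((\<lambda>t. - \<i> * (f (cis t) / cis t ^ Suc k * \<i> * cis t)) has_integral
      2 * pi / fact k * (deriv ^^ k) f 0) {0..2 * pi}"
    by (simp add: mult_ac)
  have "- \<i> * (f (cis t) / cis t ^ Suc k * \<i> * cis t) = cis (- (real k * t)) * f (cis t)" for t
  proof -
    have "- \<i> * (f (cis t) / cis t ^ Suc k * \<i> * cis t) = f (cis t) / cis t ^ k"
      by (simp add: field_simps)
    also have "\<dots> = cis (- (real k * t)) * f (cis t)"
      by (simp add: pw divide_inverse cis_inverse mult.commute)
    finally show ?thesis .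
  qed
  with * show "((\<lambda>t. cis (- (real k * t)) * f (cis t)) has_integral
      2 * pi / fact k * (deriv ^^ k) f 0) {0..2 * pi}"
    by simp
qed

lemma holomorphic_quadratic_on_cball:
  fixes f :: "complex \<Rightarrow> complex"
  assumes f: "continuous_on (cball 0 1) f" "f holomorphic_on ball 0 1"
    and zero: "\<And>k. 3 \<le> k \<Longrightarrow> (deriv ^^ k) f 0 = 0" and l: "l \<in> cball 0 1"
  shows "f l = f 0 + deriv f 0 * l + (deriv ^^ 2) f 0 / 2 * l\<^sup>2"
proof -
  let ?g = "\<lambda>l. f l - (f 0 + deriv f 0 * l + (deriv ^^ 2) f 0 / 2 * l\<^sup>2)"
  have "?g l = 0"
  proof (rule continuous_constant_on_closure[of "ball 0 1" ?g])
    show "continuous_on (closure (ball 0 1)) ?g"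
      using f by (auto intro!: continuous_intros)
    show "l \<in> closure (ball 0 1)"
      using l by simp
    show "?g u = 0" if "u \<in> ball 0 1" for u
  proof -
    have "(\<lambda>n. (deriv ^^ n) f 0 / fact n * (u - 0) ^ n) sums f u"
      using f(2) that by (rule holomorphic_power_series)
    moreover have "(\<lambda>n. (deriv ^^ n) f 0 / fact n * (u - 0) ^ n) sums
        (\<Sum>n\<in>{0,1,2}. (deriv ^^ n) f 0 / fact n * (u - 0) ^ n)"
      by (rule sums_finite) (use zero in auto)
    ultimately have "f u = (\<Sum>n\<in>{0,1,2}. (deriv ^^ n) f 0 / fact n * (u - 0) ^ n)"
      by (rule sums_unique2)
    then show ?thesis
      by simp
    qed
  qed
  then show ?thesis
    by simp
qed

section \<open>Loops in a real form\<close>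

text \<open>The graph of the conjugation of \<open>\<gg> + \<i> \<gg>\<close> with respect to \<open>\<gg>\<close>. As a relation it makes sense before
  the sum is known to be direct.\<close>

definition conjugate_wrt :: "'n::finite cmat set \<Rightarrow> 'n cmat \<Rightarrow> 'n cmat \<Rightarrow> bool"
  where "conjugate_wrt \<gg> P Q \<longleftrightarrow> (\<exists>X\<in>\<gg>. \<exists>Y\<in>\<gg>. P = X + \<i> *\<^sub>m Y \<and> Q = X - \<i> *\<^sub>m Y)"

text \<open>The condition under which the sum \<open>\<gg> + \<i> \<gg>\<close> is direct and the conjugate is unique.\<close>

definition totally_real :: "'n::finite cmat set \<Rightarrow> bool"
  where "totally_real \<gg> \<longleftrightarrow> subspace \<gg> \<and> (\<forall>X\<in>\<gg>. \<i> *\<^sub>m X \<in> \<gg> \<longrightarrow> X = 0)"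

lemma totally_real_sum_eq_0:
  assumes "totally_real \<gg>" "X \<in> \<gg>" "Y \<in> \<gg>" "X + \<i> *\<^sub>m Y = 0"
  shows "X = 0" "Y = 0"
proof -
  have "\<i> *\<^sub>m Y = - X"
    using assms(4) by (simp add: add_eq_0_iff)
  then have "\<i> *\<^sub>m Y \<in> \<gg>"
    using assms(1,2) by (simp add: totally_real_def subspace_neg)
  with assms(1,3) show "Y = 0"
    by (simp add: totally_real_def)
  with assms(4) show "X = 0"
    by (simp add: cscale.zero_right)
qed

lemma conjugate_wrt_unique:
  assumes "totally_real \<gg>" "conjugate_wrt \<gg> P Q" "conjugate_wrt \<gg> P Q'"
  shows "Q = Q'"
proof -
  obtain X Y where X: "X \<in> \<gg>" "Y \<in> \<gg>" "P = X + \<i> *\<^sub>m Y" "Q = X - \<i> *\<^sub>m Y"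
    using assms(2) by (auto simp: conjugate_wrt_def)
  obtain X' Y' where X': "X' \<in> \<gg>" "Y' \<in> \<gg>" "P = X' + \<i> *\<^sub>m Y'" "Q' = X' - \<i> *\<^sub>m Y'"
    using assms(3) by (auto simp: conjugate_wrt_def)
  have "X - X' \<in> \<gg>" "Y - Y' \<in> \<gg>"
    using assms(1) X X' by (simp_all add: totally_real_def subspace_diff)
  moreover have "(X - X') + \<i> *\<^sub>m (Y - Y') = 0"
    using X(3) X'(3) by (simp add: cscale.diff_right algebra_simps)
  ultimately have "X - X' = 0" "Y - Y' = 0"
    using totally_real_sum_eq_0[OF assms(1)] by blast+
  then show ?thesis
    by (simp add: X X')
qed

text \<open>Conjugation is antilinear. This is why the conjugate of a form of type \<open>(1,0)\<close> is of type \<open>(0,1)\<close>.\<close>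

lemma conjugate_wrt_i:
  assumes "totally_real \<gg>" "conjugate_wrt \<gg> P Q"
  shows "conjugate_wrt \<gg> (\<i> *\<^sub>m P) (- (\<i> *\<^sub>m Q))"
proof -
  obtain X Y where X: "X \<in> \<gg>" "Y \<in> \<gg>" "P = X + \<i> *\<^sub>m Y" "Q = X - \<i> *\<^sub>m Y"
    using assms(2) by (auto simp: conjugate_wrt_def)
  show ?thesis
    unfolding conjugate_wrt_def
  proof (intro bexI conjI)
    show "\<i> *\<^sub>m P = - Y + \<i> *\<^sub>m X" "- (\<i> *\<^sub>m Q) = - Y - \<i> *\<^sub>m X"
      by (simp_all add: vec_eq_iff X algebra_simps)
    show "- Y \<in> \<gg>" "X \<in> \<gg>"
      using assms(1) X by (simp_all add: totally_real_def subspace_neg)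
  qed
qed

lemma conjugate_wrt_scaleR:
  assumes "totally_real \<gg>" "conjugate_wrt \<gg> P Q"
  shows "conjugate_wrt \<gg> (r *\<^sub>R P) (r *\<^sub>R Q)"
proof -
  obtain X Y where X: "X \<in> \<gg>" "Y \<in> \<gg>" "P = X + \<i> *\<^sub>m Y" "Q = X - \<i> *\<^sub>m Y"
    using assms(2) by (auto simp: conjugate_wrt_def)
  show ?thesis
    unfolding conjugate_wrt_def
  proof (intro bexI conjI)
    show "r *\<^sub>R P = r *\<^sub>R X + \<i> *\<^sub>m (r *\<^sub>R Y)" "r *\<^sub>R Q = r *\<^sub>R X - \<i> *\<^sub>m (r *\<^sub>R Y)"
      by (simp_all add: X cscale.scaleR_right scaleR_right_distrib scaleR_right_diff_distrib)
    show "r *\<^sub>R X \<in> \<gg>" "r *\<^sub>R Y \<in> \<gg>"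
      using assms(1) X by (simp_all add: totally_real_def subspace_scale)
  qed
qed

text \<open>The component of the integral orthogonal to \<open>S\<close> is orthogonal to all values of \<open>f\<close>, hence to the
  integral itself.\<close>

lemma integral_in_subspace:
  fixes f :: "'a::euclidean_space \<Rightarrow> 'b::euclidean_space"
  assumes S: "subspace S" and f: "f integrable_on I" "\<And>x. x \<in> I \<Longrightarrow> f x \<in> S"
  shows "integral I f \<in> S"
proof -
  let ?v = "integral I f"
  obtain p q where pq: "p \<in> span S" "\<And>v. v \<in> span S \<Longrightarrow> orthogonal q v" "?v = p + q"
    using orthogonal_subspace_decomp_exists[of S ?v] by blast
  have "((\<lambda>x. f x \<bullet> q) has_integral ?v \<bullet> q) I"
    using has_integral_linear[OF integrable_integral[OF f(1)] bounded_linear_inner_left] by (simp add: o_def)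
  moreover have "f x \<bullet> q = 0" if "x \<in> I" for x
    using pq(2)[of "f x"] f(2)[OF that] by (simp add: span_base orthogonal_def inner_commute)
  ultimately have "((\<lambda>x. 0::real) has_integral ?v \<bullet> q) I"
    using has_integral_cong[of I "\<lambda>x. f x \<bullet> q" "\<lambda>x. 0"] by simp
  then have "?v \<bullet> q = 0"
    using has_integral_0_eq by blast
  moreover have "p \<bullet> q = 0"
    using pq(1,2) by (simp add: orthogonal_def inner_commute)
  ultimately have "q = 0"
    by (simp add: pq(3) inner_add_left)
  with pq S show ?thesis
    by (simp add: span_eq_iff[THEN iffD2])
qed

text \<open>The Fourier integrals are \<open>X \<plusminus> \<i> Y\<close>, where \<open>X\<close> and \<open>Y\<close> are the cosine and sine integrals; the latter
  lie in \<open>\<gg>\<close>, as \<open>a\<close> does.\<close>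

lemma loop_moments_conjugate:
  fixes a :: "complex \<Rightarrow> 'n::finite cmat"
  assumes \<gg>: "totally_real \<gg>" and a: "continuous_on (sphere 0 1) a" "\<And>l. l \<in> sphere 0 1 \<Longrightarrow> a l \<in> \<gg>"
  shows "conjugate_wrt \<gg> (integral {0..2 * pi} (\<lambda>t. cis (r * t) *\<^sub>m a (cis t)))
    (integral {0..2 * pi} (\<lambda>t. cis (- (r * t)) *\<^sub>m a (cis t)))"
proof -
  have S: "subspace \<gg>"
    using \<gg> by (simp add: totally_real_def)
  have cont: "continuous_on {0..2 * pi} (\<lambda>t. a (cis t))"
    by (rule continuous_on_compose2[OF a(1)]) (auto intro: continuous_intros)
  define X where "X = integral {0..2 * pi} (\<lambda>t. cos (r * t) *\<^sub>R a (cis t))"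
  define Y where "Y = integral {0..2 * pi} (\<lambda>t. sin (r * t) *\<^sub>R a (cis t))"
  have int: "(\<lambda>t. cos (r * t) *\<^sub>R a (cis t)) integrable_on {0..2 * pi}"
    "(\<lambda>t. sin (r * t) *\<^sub>R a (cis t)) integrable_on {0..2 * pi}"
    by (intro integrable_continuous_interval continuous_intros cont)+
  have XY: "X \<in> \<gg>" "Y \<in> \<gg>"
    unfolding X_def Y_def
    by (intro integral_in_subspace S int; simp add: subspace_scale S a(2))+
  have Yi: "((\<lambda>t. \<i> *\<^sub>m (sin (r * t) *\<^sub>R a (cis t))) has_integral \<i> *\<^sub>m Y) {0..2 * pi}"
    using has_integral_linear[OF integrable_integral[OF int(2)] cscale.bounded_linear_right[of \<i>]]
    by (simp add: o_def Y_def)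
  note Xi = integrable_integral[OF int(1), folded X_def]
  have "integral {0..2 * pi} (\<lambda>t. cis (r * t) *\<^sub>m a (cis t)) = X + \<i> *\<^sub>m Y"
  proof (rule integral_unique)
    have "cis (r * t) *\<^sub>m a (cis t) = cos (r * t) *\<^sub>R a (cis t) + \<i> *\<^sub>m (sin (r * t) *\<^sub>R a (cis t))" for t
      by (simp add: vec_eq_iff complex_eq_iff)
    then show "((\<lambda>t. cis (r * t) *\<^sub>m a (cis t)) has_integral X + \<i> *\<^sub>m Y) {0..2 * pi}"
      using has_integral_add[OF Xi Yi] by simp
  qed
  moreover have "integral {0..2 * pi} (\<lambda>t. cis (- (r * t)) *\<^sub>m a (cis t)) = X - \<i> *\<^sub>m Y"
  proof (rule integral_unique)
    have "cis (- (r * t)) *\<^sub>m a (cis t) = cos (r * t) *\<^sub>R a (cis t) - \<i> *\<^sub>m (sin (r * t) *\<^sub>R a (cis t))" for t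
      by (simp add: vec_eq_iff complex_eq_iff)
    then show "((\<lambda>t. cis (- (r * t)) *\<^sub>m a (cis t)) has_integral X - \<i> *\<^sub>m Y) {0..2 * pi}"
      using has_integral_diff[OF Xi Yi] by simp
  qed
  ultimately show ?thesis
    using XY by (auto simp: conjugate_wrt_def)
qed

text \<open>A loop in \<open>\<gg>\<close> with at most a simple pole at \<open>0\<close> has no Fourier coefficients below \<open>-1\<close>, hence by
  reality none above \<open>1\<close>. In terms of the extension \<open>H\<close> of \<open>\<lambda> a(\<lambda>)\<close>, its Taylor series stops after the
  quadratic term, and the quadratic coefficient \<open>C\<close> is conjugate to the constant one.\<close>

lemma real_loop_with_simple_pole:
  fixes a :: "complex \<Rightarrow> 'n::finite cmat"
  assumes \<gg>: "totally_real \<gg>" and a: "\<And>l. l \<in> sphere 0 1 \<Longrightarrow> a l \<in> \<gg>"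
    and H: "disk_extension (\<lambda>l. l *\<^sub>m a l) H"
  obtains A0 C where "conjugate_wrt \<gg> (H 0) C"
    "\<And>l. l \<in> sphere 0 1 \<Longrightarrow> a l = inverse l *\<^sub>m H 0 + A0 + l *\<^sub>m C"
proof -
  note H' = disk_extensionD[OF H]
  let ?c = "\<lambda>k. \<chi> i j. (deriv ^^ k) (\<lambda>l. H l $ i $ j) 0"
  have cont_H: "continuous_on (cball 0 1) (\<lambda>l. H l $ i $ j)" for i j
    by (intro bounded_linear.continuous_on[OF bounded_linear_entry] H')
  have a_eq: "a l = inverse l *\<^sub>m H l" if "l \<in> sphere 0 1" for l
    using H'(3)[OF that] that by (cases "l = 0") auto
  have cont: "continuous_on (sphere 0 1) a"
  proof -
    have "continuous_on (sphere 0 1) (\<lambda>l. inverse l *\<^sub>m H l)"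
      by (intro bounded_bilinear.continuous_on[OF bounded_bilinear_cscale] continuous_intros
          continuous_on_subset[OF H'(1)]) auto
    then show ?thesis
      by (rule continuous_on_eq) (use a_eq in auto)
  qed
  have int: "(\<lambda>t. cis (r * t) *\<^sub>m a (cis t)) integrable_on {0..2 * pi}" for r
    by (intro integrable_continuous_interval bounded_bilinear.continuous_on[OF bounded_bilinear_cscale]
        continuous_intros continuous_on_compose2[OF cont]) auto
  have a_cis: "a (cis t) = cis (- t) *\<^sub>m H (cis t)" for t
    using a_eq[of "cis t"] by (simp add: cis_inverse)
  have entry: "integral {0..2 * pi} (\<lambda>t. cis (r * t) *\<^sub>m a (cis t)) $ i $ j = m"
    if "((\<lambda>t. cis ((r - 1) * t) * H (cis t) $ i $ j) has_integral m) {0..2 * pi}" for r i j m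
  proof -
    have eq: "(cis (r * t) *\<^sub>m a (cis t)) $ i $ j = cis ((r - 1) * t) * H (cis t) $ i $ j" for t
      by (simp add: a_cis cis_mult algebra_simps)
    have "((\<lambda>t. cis ((r - 1) * t) * H (cis t) $ i $ j) has_integral
        integral {0..2 * pi} (\<lambda>t. cis (r * t) *\<^sub>m a (cis t)) $ i $ j) {0..2 * pi}"
      using has_integral_linear[OF integrable_integral[OF int[of r]] bounded_linear_entry[of i j]]
      by (simp only: o_def eq)
    then show ?thesis
      using that by (rule has_integral_unique)
  qed
  (* in terms of H the index of a moment of a is shifted by one *)
  have pos: "integral {0..2 * pi} (\<lambda>t. cis (real n * t) *\<^sub>m a (cis t)) = 0" if "2 \<le> n" for n
  proof -
    have "integral {0..2 * pi} (\<lambda>t. cis (real n * t) *\<^sub>m a (cis t)) $ i $ j = 0" for i j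
    proof (rule entry)
      have "real n - 1 = real (n - 2) + 1"
        using that by simp
      then show "((\<lambda>t. cis ((real n - 1) * t) * H (cis t) $ i $ j) has_integral 0) {0..2 * pi}"
        using has_integral_boundary_moment(1)[OF cont_H[of i j] H'(2)[of i j], of "n - 2"] by (simp only:)
    qed
    then show ?thesis
      by (simp add: vec_eq_iff)
  qed
  have neg: "integral {0..2 * pi} (\<lambda>t. cis (- (real n * t)) *\<^sub>m a (cis t)) =
      (2 * pi / fact (n + 1)) *\<^sub>R ?c (n + 1)" for n
  proof -
    have "integral {0..2 * pi} (\<lambda>t. cis (- real n * t) *\<^sub>m a (cis t)) $ i $ j =
        2 * pi / fact (n + 1) * (deriv ^^ (n + 1)) (\<lambda>l. H l $ i $ j) 0" for i j
    proof (rule entry)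
      have "(- real n - 1) * t = - (real (n + 1) * t)" for t
        by (simp add: algebra_simps)
      then show "((\<lambda>t. cis ((- real n - 1) * t) * H (cis t) $ i $ j) has_integral
          2 * pi / fact (n + 1) * (deriv ^^ (n + 1)) (\<lambda>l. H l $ i $ j) 0) {0..2 * pi}"
        using has_integral_boundary_moment(2)[OF cont_H[of i j] H'(2)[of i j], of "n + 1"] by simp
    qed
    then show ?thesis
      by (simp add: vec_eq_iff scaleR_conv_of_real[where 'a = complex] del: fact_Suc funpow.simps)
  qed
  have one: "integral {0..2 * pi} (\<lambda>t. cis (real 1 * t) *\<^sub>m a (cis t)) = (2 * pi) *\<^sub>R H 0"
  proof -
    have "integral {0..2 * pi} (\<lambda>t. cis (1 * t) *\<^sub>m a (cis t)) $ i $ j = 2 * pi * H 0 $ i $ j" for i j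
    proof (rule entry)
      show "((\<lambda>t. cis ((1 - 1) * t) * H (cis t) $ i $ j) has_integral 2 * pi * H 0 $ i $ j) {0..2 * pi}"
        using has_integral_boundary_moment(2)[OF cont_H[of i j] H'(2)[of i j], of 0] by simp
    qed
    then show ?thesis
      by (simp add: vec_eq_iff complex_eq_iff)
  qed
  have "?c k = 0" if "3 \<le> k" for k
  proof -
    define n where "n = k - 1"
    have n: "k = n + 1" "2 \<le> n"
      using that by (auto simp: n_def)
    have "conjugate_wrt \<gg> 0 ((2 * pi / fact k) *\<^sub>R ?c k)"
      using loop_moments_conjugate[OF \<gg> cont a, of "real n"] unfolding pos[OF n(2)] neg n(1) by simp
    moreover have "conjugate_wrt \<gg> 0 0"
      using \<gg> by (auto simp: conjugate_wrt_def totally_real_def cscale.zero_right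
          intro!: bexI[of _ 0] subspace_0)
    ultimately have "(2 * pi / fact k) *\<^sub>R ?c k = 0"
      by (rule conjugate_wrt_unique[OF \<gg>])
    then show ?thesis
      by simp
  qed
  then have c0: "(deriv ^^ k) (\<lambda>l. H l $ i $ j) 0 = 0" if "3 \<le> k" for k i j
    using that by (simp add: vec_eq_iff)
  have "conjugate_wrt \<gg> ((2 * pi) *\<^sub>R H 0) ((2 * pi) *\<^sub>R ((1 / 2) *\<^sub>R ?c 2))"
    using loop_moments_conjugate[OF \<gg> cont a, of "real 1"] unfolding one neg by (simp add: numeral_2_eq_2)
  from conjugate_wrt_scaleR[OF \<gg> this, of "1 / (2 * pi)"]
  have "conjugate_wrt \<gg> (H 0) ((1 / 2) *\<^sub>R ?c 2)"
    by simp
  moreover have "a l = inverse l *\<^sub>m H 0 + ?c 1 + l *\<^sub>m ((1 / 2) *\<^sub>R ?c 2)" if l: "l \<in> sphere 0 1" for l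
  proof -
    have "l \<noteq> 0"
      using l by auto
    have "H l $ i $ j = H 0 $ i $ j + ?c 1 $ i $ j * l + ?c 2 $ i $ j / 2 * l\<^sup>2" for i j
      using holomorphic_quadratic_on_cball[OF cont_H[of i j] H'(2)[of i j] c0, of l] l by simp
    then show ?thesis
      unfolding a_eq[OF l] using \<open>l \<noteq> 0\<close>
      by (simp add: vec_eq_iff power2_eq_square scaleR_conv_of_real[where 'a = complex] field_simps)
  qed
  ultimately show ?thesis
    using that by blast
qed

section \<open>Logarithmic derivatives of maps into a matrix group\<close>

text \<open>Velocities add under products of curves and scale under linear changes of the parameter.\<close>

lemma subspace_lie_algebra:
  fixes H :: "'n::finite cmat set"
  assumes H: "mat_subgroup H"
  shows "subspace (lie_algebra H)"
proof (rule subspaceI)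
  show "0 \<in> lie_algebra H"
    unfolding lie_algebra_def mem_Collect_eq using H
    by (intro exI[of _ "1::real"] conjI exI[of _ "\<lambda>_. mat 1"] exI[of _ "\<lambda>_. 0"])
       (auto simp: mat_subgroup_def)
next
  fix X Y
  assume "X \<in> lie_algebra H"
  then obtain e c c' where c: "e > 0" "\<And>t. t \<in> {-e<..<e::real} \<Longrightarrow> c t \<in> H"
    "\<And>t. t \<in> {-e<..<e} \<Longrightarrow> (c has_vector_derivative c' t) (at t)"
    "continuous_on {-e<..<e} c'" "c 0 = mat 1" "c' 0 = X"
    unfolding lie_algebra_def mem_Collect_eq by metis
  assume "Y \<in> lie_algebra H"
  then obtain \<epsilon> d d' where d: "\<epsilon> > 0" "\<And>t. t \<in> {-\<epsilon><..<\<epsilon>::real} \<Longrightarrow> d t \<in> H"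
    "\<And>t. t \<in> {-\<epsilon><..<\<epsilon>} \<Longrightarrow> (d has_vector_derivative d' t) (at t)"
    "continuous_on {-\<epsilon><..<\<epsilon>} d'" "d 0 = mat 1" "d' 0 = Y"
    unfolding lie_algebra_def mem_Collect_eq by metis
  let ?\<delta> = "min e \<epsilon>"
  have sub: "{- ?\<delta><..<?\<delta>} \<subseteq> {-e<..<e}" "{- ?\<delta><..<?\<delta>} \<subseteq> {-\<epsilon><..<\<epsilon>}"
    by auto
  have "((\<lambda>t. c t ** d t) has_vector_derivative c t ** d' t + c' t ** d t) (at t)"
    if "t \<in> {- ?\<delta><..<?\<delta>}" for t
    using that sub c d by (intro bounded_bilinear.has_vector_derivative[OF bounded_bilinear_matrix_mult]) auto
  moreover have "c t ** d t \<in> H" if "t \<in> {- ?\<delta><..<?\<delta>}" for t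
    using that sub c(2)[of t] d(2)[of t] H by (auto simp: mat_subgroup_def)
  moreover have "continuous_on {- ?\<delta><..<?\<delta>} c" "continuous_on {- ?\<delta><..<?\<delta>} d"
    using sub by (auto intro!: continuous_at_imp_continuous_on
        has_vector_derivative_continuous[OF c(3)] has_vector_derivative_continuous[OF d(3)])
  then have "continuous_on {- ?\<delta><..<?\<delta>} (\<lambda>t. c t ** d' t + c' t ** d t)"
    using continuous_on_subset[OF c(4) sub(1)] continuous_on_subset[OF d(4) sub(2)]
    by (intro continuous_on_add bounded_bilinear.continuous_on[OF bounded_bilinear_matrix_mult])
  ultimately show "X + Y \<in> lie_algebra H"
    unfolding lie_algebra_def mem_Collect_eq using c(1,5,6) d(1,5,6)
    by (intro exI[of _ ?\<delta>] conjI exI[of _ "\<lambda>t. c t ** d t"] exI[of _ "\<lambda>t. c t ** d' t + c' t ** d t"])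
       (auto simp: add.commute)
next
  fix X and r :: real
  assume "X \<in> lie_algebra H"
  then obtain e c c' where c: "e > 0" "\<And>t. t \<in> {-e<..<e::real} \<Longrightarrow> c t \<in> H"
    "\<And>t. t \<in> {-e<..<e} \<Longrightarrow> (c has_vector_derivative c' t) (at t)"
    "continuous_on {-e<..<e} c'" "c 0 = mat 1" "c' 0 = X"
    unfolding lie_algebra_def mem_Collect_eq by metis
  (* the summand 1 covers the case r = 0 *)
  let ?\<delta> = "e / (\<bar>r\<bar> + 1)"
  have \<delta>: "?\<delta> > 0"
    using c(1) by simp
  have sub: "r * t \<in> {-e<..<e}" if "t \<in> {- ?\<delta><..<?\<delta>}" for t
  proof -
    have "\<bar>t\<bar> < ?\<delta>"
      using that by (auto simp: abs_less_iff)
    then have "\<bar>t\<bar> * (\<bar>r\<bar> + 1) < e"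
      by (simp add: pos_less_divide_eq)
    then have "\<bar>r * t\<bar> < e"
      by (simp add: abs_mult algebra_simps)
    then show ?thesis
      by (auto simp: abs_less_iff)
  qed
  have "((\<lambda>t. c (r * t)) has_vector_derivative r *\<^sub>R c' (r * t)) (at t)" if "t \<in> {- ?\<delta><..<?\<delta>}" for t
  proof -
    have "((\<lambda>t. r * t) has_vector_derivative r) (at t)"
      by (auto intro!: derivative_eq_intros simp: has_vector_derivative_def)
    from vector_diff_chain_at[OF this c(3)[OF sub[OF that]]] show ?thesis
      by (simp add: o_def)
  qed
  moreover have "continuous_on {- ?\<delta><..<?\<delta>} (\<lambda>t. r *\<^sub>R c' (r * t))"
    by (intro continuous_intros continuous_on_compose2[OF c(4)]) (use sub in auto)
  moreover have "c (r * t) \<in> H" if "t \<in> {- ?\<delta><..<?\<delta>}" for t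
    using c(2) sub that by blast
  ultimately show "r *\<^sub>R X \<in> lie_algebra H"
    unfolding lie_algebra_def mem_Collect_eq using \<delta> c(5,6)
    by (intro exI[of _ ?\<delta>] conjI exI[of _ "\<lambda>t. c (r * t)"] exI[of _ "\<lambda>t. r *\<^sub>R c' (r * t)"]) auto
qed

lemma totally_real_lie_algebra:
  "linear_complexification G GC \<Longrightarrow> totally_real (lie_algebra G)"
  by (simp add: linear_complexification_def connected_linear_lie_group_def totally_real_def subspace_lie_algebra)

text \<open>The curve \<open>f(z)\<inverse> f(z + t h)\<close> runs in \<open>H\<close>, through the identity at \<open>t = 0\<close>.\<close>

lemma logarithmic_derivative_in_lie_algebra:
  fixes f :: "complex \<Rightarrow> 'n::finite cmat"
  assumes H: "mat_subgroup H" and U: "open U" "z \<in> U" and f: "smooth_map_on U f" "\<And>z. z \<in> U \<Longrightarrow> f z \<in> H"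
  shows "matrix_inv (f z) ** (Re h *\<^sub>R dx f z + Im h *\<^sub>R dy f z) \<in> lie_algebra H"
proof -
  obtain r where r: "r > 0" "ball z r \<subseteq> U"
    using U openE by blast
  define e where "e = r / (norm h + 1)"
  have e: "e > 0"
    using r by (simp add: e_def add_nonneg_pos)
  have near: "z + t *\<^sub>R h \<in> U" if "t \<in> {-e<..<e}" for t
  proof -
    have "\<bar>t\<bar> < e"
      using that by (auto simp: abs_less_iff)
    then have "\<bar>t\<bar> * (norm h + 1) < r"
      by (simp add: e_def pos_less_divide_eq add_nonneg_pos)
    then have "\<bar>t\<bar> * norm h < r"
      by (simp add: algebra_simps)
    then have "dist z (z + t *\<^sub>R h) < r"
      by (simp add: dist_norm)
    then show ?thesis
      using r by auto
  qed
  let ?c = "\<lambda>t. matrix_inv (f z) ** f (z + t *\<^sub>R h)"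
  let ?c' = "\<lambda>t. matrix_inv (f z) ** (Re h *\<^sub>R dx f (z + t *\<^sub>R h) + Im h *\<^sub>R dy f (z + t *\<^sub>R h))"
  have "(?c has_vector_derivative ?c' t) (at t)" if "t \<in> {-e<..<e}" for t
  proof -
    have "((\<lambda>t. z + t *\<^sub>R h) has_derivative (\<lambda>s. s *\<^sub>R h)) (at t)"
      by (auto intro!: derivative_eq_intros)
    from has_derivative_compose[OF this has_derivative_dx_dy[OF
        smooth_map_on_imp_differentiable[OF f(1) near[OF that]]]]
    have "((\<lambda>t. f (z + t *\<^sub>R h)) has_vector_derivative
        Re h *\<^sub>R dx f (z + t *\<^sub>R h) + Im h *\<^sub>R dy f (z + t *\<^sub>R h)) (at t)"
      by (simp add: has_vector_derivative_def scaleR_right_distrib)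
    from bounded_linear.has_vector_derivative[OF matmul.bounded_linear_right this] show ?thesis .
  qed
  moreover have "?c t \<in> H" if "t \<in> {-e<..<e}" for t
    using H f(2)[OF near[OF that]] f(2)[OF U(2)] by (auto simp: mat_subgroup_def)
  moreover have "continuous_on {-e<..<e} ?c'"
  proof -
    have "continuous_on U (dx f)" "continuous_on U (dy f)"
      using smooth_map_on_dx[OF U(1) f(1)] smooth_map_on_dy[OF U(1) f(1)]
      unfolding smooth_map_on_def by (auto dest: spec[of _ 0])
    note this[THEN continuous_on_compose2, of "{-e<..<e}" "\<lambda>t. z + t *\<^sub>R h"]
    moreover have "continuous_on {-e<..<e} (\<lambda>t. z + t *\<^sub>R h)"
      by (intro continuous_intros)
    moreover have "(\<lambda>t. z + t *\<^sub>R h) ` {-e<..<e} \<subseteq> U"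
      using near by blast
    ultimately have "continuous_on {-e<..<e} (\<lambda>t. dx f (z + t *\<^sub>R h))"
      "continuous_on {-e<..<e} (\<lambda>t. dy f (z + t *\<^sub>R h))"
      by blast+
    then show ?thesis
      by (intro bounded_linear.continuous_on[OF matmul.bounded_linear_right] continuous_on_add
          continuous_on_scaleR continuous_on_const)
  qed
  moreover have "?c 0 = mat 1"
    using H f(2)[OF U(2)] by (simp add: mat_subgroup_def matrix_inv_inverse)
  ultimately show ?thesis
    unfolding lie_algebra_def mem_Collect_eq
    by (intro exI[of _ e] conjI e exI[of _ ?c] exI[of _ ?c'] ballI) auto
qed

lemma dx_dy_mult:
  fixes f g :: "complex \<Rightarrow> 'n::finite cmat"
  assumes "f differentiable at z" "g differentiable at z"
  shows "dx (\<lambda>z. f z ** g z) z = f z ** dx g z + dx f z ** g z"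
    "dy (\<lambda>z. f z ** g z) z = f z ** dy g z + dy f z ** g z"
  using dx_dy_eqI[OF matmul.FDERIV[OF assms[THEN has_derivative_dx_dy]]] by simp_all

lemma dx_dy_diff:
  assumes "f differentiable at z" "g differentiable at z"
  shows "dx (\<lambda>z. f z - g z) z = dx f z - dx g z" "dy (\<lambda>z. f z - g z) z = dy f z - dy g z"
  using dx_dy_eqI[OF has_derivative_diff[OF assms[THEN has_derivative_dx_dy]]] by simp_all

lemma dx_dy_matrix_inv:
  fixes f :: "complex \<Rightarrow> 'n::finite cmat"
  assumes "open U" "z \<in> U" "\<And>z. z \<in> U \<Longrightarrow> invertible (f z)" "f differentiable at z"
  shows "dx (\<lambda>z. matrix_inv (f z)) z = - (matrix_inv (f z) ** dx f z ** matrix_inv (f z))"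
    "dy (\<lambda>z. matrix_inv (f z)) z = - (matrix_inv (f z) ** dy f z ** matrix_inv (f z))"
  using dx_dy_eqI[OF has_derivative_matrix_inv[OF has_derivative_dx_dy[OF assms(4)] assms(1-3)]]
  by simp_all

definition log_dx :: "(complex \<Rightarrow> 'n::finite cmat) \<Rightarrow> complex \<Rightarrow> 'n cmat"
  where "log_dx f z = matrix_inv (f z) ** dx f z"

definition log_dy :: "(complex \<Rightarrow> 'n::finite cmat) \<Rightarrow> complex \<Rightarrow> 'n cmat"
  where "log_dy f z = matrix_inv (f z) ** dy f z"

definition smooth_frame :: "complex set \<Rightarrow> (complex \<Rightarrow> 'n::finite cmat) \<Rightarrow> bool"
  where "smooth_frame U f \<longleftrightarrow> open U \<and> smooth_map_on U f \<and> (\<forall>z\<in>U. invertible (f z))"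

lemma smooth_frameD:
  assumes "smooth_frame U f"
  shows "open U" "smooth_map_on U f" "z \<in> U \<Longrightarrow> invertible (f z)" "z \<in> U \<Longrightarrow> f differentiable at z"
    "smooth_map_on U (\<lambda>z. matrix_inv (f z))" "z \<in> U \<Longrightarrow> (\<lambda>z. matrix_inv (f z)) differentiable at z"
    "smooth_map_on U (dx f)" "z \<in> U \<Longrightarrow> dx f differentiable at z"
    "smooth_map_on U (dy f)" "z \<in> U \<Longrightarrow> dy f differentiable at z"
    "smooth_map_on U (log_dx f)" "z \<in> U \<Longrightarrow> log_dx f differentiable at z"
    "smooth_map_on U (log_dy f)" "z \<in> U \<Longrightarrow> log_dy f differentiable at z"
proof -
  show *: "open U" "smooth_map_on U f" "z \<in> U \<Longrightarrow> invertible (f z)"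
    using assms by (auto simp: smooth_frame_def)
  show i: "smooth_map_on U (\<lambda>z. matrix_inv (f z))"
    using assms by (intro smooth_map_on_matrix_inv) (auto simp: smooth_frame_def)
  show d: "smooth_map_on U (dx f)" "smooth_map_on U (dy f)"
    by (intro smooth_map_on_dx smooth_map_on_dy *)+
  show l: "smooth_map_on U (log_dx f)" "smooth_map_on U (log_dy f)"
    unfolding log_dx_def[abs_def] log_dy_def[abs_def] by (intro smooth_map_on_matrix_mult i d)+
  show "z \<in> U \<Longrightarrow> f differentiable at z" "z \<in> U \<Longrightarrow> (\<lambda>z. matrix_inv (f z)) differentiable at z"
    "z \<in> U \<Longrightarrow> dx f differentiable at z" "z \<in> U \<Longrightarrow> dy f differentiable at z"
    "z \<in> U \<Longrightarrow> log_dx f differentiable at z" "z \<in> U \<Longrightarrow> log_dy f differentiable at z"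
    using smooth_map_on_imp_differentiable *(2) i d l by auto
qed

lemma smooth_frame_mult_inv:
  assumes "smooth_frame U f" "smooth_frame U g"
  shows "smooth_frame U (\<lambda>z. f z ** matrix_inv (g z))"
  unfolding smooth_frame_def
  using assms[THEN smooth_frameD(1)] assms[THEN smooth_frameD(2)] assms[THEN smooth_frameD(3)]
    assms[THEN smooth_frameD(5)]
  by (auto intro!: smooth_map_on_matrix_mult invertible_mult invertible_matrix_inv)

lemma smooth_frame_cong:
  assumes f: "smooth_frame U f" and eq: "\<And>z. z \<in> U \<Longrightarrow> f z = g z"
  shows "smooth_frame U g" "z \<in> U \<Longrightarrow> dx (log_dx g) z = dx (log_dx f) z"
    "z \<in> U \<Longrightarrow> dy (log_dy g) z = dy (log_dy f) z"
proof -
  note F = smooth_frameD[OF f]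
  show "smooth_frame U g"
    using f eq smooth_map_on_cong[OF F(1) eq F(2)] by (auto simp: smooth_frame_def)
  have eq': "log_dx f z = log_dx g z" "log_dy f z = log_dy g z" if "z \<in> U" for z
    using dx_dy_cong[OF F(1) that eq F(4)[OF that]] eq[OF that] by (simp_all add: log_dx_def log_dy_def)
  show "z \<in> U \<Longrightarrow> dx (log_dx g) z = dx (log_dx f) z" "z \<in> U \<Longrightarrow> dy (log_dy g) z = dy (log_dy f) z"
    using dx_dy_cong(1)[OF F(1) _ eq'(1) F(12)] dx_dy_cong(2)[OF F(1) _ eq'(2) F(14)] by simp_all
qed

lemma maurer_cartan_eq:
  assumes "f differentiable at z"
  shows "maurer_cartan f z h = Re h *\<^sub>R log_dx f z + Im h *\<^sub>R log_dy f z"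
  by (simp add: maurer_cartan_def frechet_derivative_dx_dy[OF assms] log_dx_def log_dy_def
      matmul.add_right matmul.scaleR_right)

text \<open>Flatness of \<open>f\<inverse> df\<close> is the symmetry of the second derivatives of \<open>f\<close>.\<close>

lemma maurer_cartan_equation:
  assumes f: "smooth_frame U f" and z: "z \<in> U"
  shows "dx (log_dy f) z - dy (log_dx f) z + commutator (log_dx f z) (log_dy f z) = 0"
proof -
  note F = smooth_frameD[OF f]
  have "dx (log_dy f) z = matrix_inv (f z) ** dx (dy f) z - log_dx f z ** log_dy f z"
    unfolding log_dy_def[abs_def] log_dx_def
    by (simp add: dx_dy_mult F z dx_dy_matrix_inv[OF F(1) z F(3)] matmul.minus_left matrix_mul_assoc)
  moreover have "dy (log_dx f) z = matrix_inv (f z) ** dy (dx f) z - log_dy f z ** log_dx f z"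
    unfolding log_dx_def[abs_def] log_dy_def
    by (simp add: dx_dy_mult F z dx_dy_matrix_inv[OF F(1) z F(3)] matmul.minus_left matrix_mul_assoc)
  moreover have "dx (dy f) z = dy (dx f) z"
    by (rule dx_dy_commute[OF F(1) z F(2)])
  ultimately show ?thesis
    by (simp add: commutator_def)
qed

lemma log_derivative_mult_inv:
  assumes f: "smooth_frame U f" and g: "smooth_frame U g" and z: "z \<in> U"
  shows "log_dx (\<lambda>z. f z ** matrix_inv (g z)) z = g z ** (log_dx f z - log_dx g z) ** matrix_inv (g z)"
    "log_dy (\<lambda>z. f z ** matrix_inv (g z)) z = g z ** (log_dy f z - log_dy g z) ** matrix_inv (g z)"
proof -
  note F = smooth_frameD[OF f] and G = smooth_frameD[OF g]
  have inv: "matrix_inv (f z ** matrix_inv (g z)) = g z ** matrix_inv (f z)"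
    by (simp add: matrix_inv_mult invertible_matrix_inv matrix_inv_matrix_inv F G z)
  show "log_dx (\<lambda>z. f z ** matrix_inv (g z)) z = g z ** (log_dx f z - log_dx g z) ** matrix_inv (g z)"
    "log_dy (\<lambda>z. f z ** matrix_inv (g z)) z = g z ** (log_dy f z - log_dy g z) ** matrix_inv (g z)"
    unfolding log_dx_def log_dy_def inv
    by (simp_all add: dx_dy_mult F G z dx_dy_matrix_inv[OF G(1) z G(3)] matmul.minus_left matmul.minus_right
        matmul.add_right matmul.diff_left matmul.diff_right matrix_mul_assoc mult_inv_cancel)
qed

lemma dx_dy_conjugate:
  assumes g: "smooth_frame U g" and z: "z \<in> U" and X: "X differentiable at z"
  shows "dx (\<lambda>z. g z ** X z ** matrix_inv (g z)) z
      = g z ** (dx X z + commutator (log_dx g z) (X z)) ** matrix_inv (g z)"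
    "dy (\<lambda>z. g z ** X z ** matrix_inv (g z)) z
      = g z ** (dy X z + commutator (log_dy g z) (X z)) ** matrix_inv (g z)"
proof -
  note G = smooth_frameD[OF g]
  have gX: "(\<lambda>z. g z ** X z) differentiable at z"
    using matmul.FDERIV[OF has_derivative_dx_dy[OF G(4)[OF z]] has_derivative_dx_dy[OF X]]
    by (auto simp: differentiable_def)
  show "dx (\<lambda>z. g z ** X z ** matrix_inv (g z)) z
      = g z ** (dx X z + commutator (log_dx g z) (X z)) ** matrix_inv (g z)"
    "dy (\<lambda>z. g z ** X z ** matrix_inv (g z)) z
      = g z ** (dy X z + commutator (log_dy g z) (X z)) ** matrix_inv (g z)"
    by (simp_all add: dx_dy_mult gX X G z dx_dy_matrix_inv[OF G(1) z G(3)] commutator_def log_dx_def log_dy_def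
        matmul.minus_left matmul.minus_right matmul.add_left matmul.add_right matmul.diff_left
        matmul.diff_right matrix_mul_assoc mult_inv_cancel matrix_inv_inverse)
qed

section \<open>Harmonic maps and flat families of connections\<close>

lemma has_derivative_inverse_sqrt:
  fixes \<rho> :: "complex \<Rightarrow> real"
  assumes "(\<rho> has_derivative D) (at z)" "0 < \<rho> z"
  shows "((\<lambda>p. 1 / sqrt (\<rho> p)) has_derivative (\<lambda>h. - (D h / (2 * \<rho> z * sqrt (\<rho> z))))) (at z)"
  using assms by (auto intro!: derivative_eq_intros simp: field_simps)

text \<open>The bracket of the neutral connection vanishes on equal arguments. The unit vector field for the
  metric is \<open>s e\<close> with \<open>s = 1 / sqrt \<rho>\<close>; the derivative of \<open>s\<close> enters through the product rule on the one
  hand and through the Levi-Civita connection on the other, and cancels. Only the Christoffel terms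
  of the conformal factor remain.\<close>

lemma second_fundamental_form_neutral:
  fixes \<phi> :: "complex \<Rightarrow> 'n::finite cmat"
  assumes U: "open U" "z \<in> U" and \<phi>: "\<And>p. p \<in> U \<Longrightarrow> \<phi> differentiable at p" "invertible (\<phi> z)"
    and \<rho>: "\<rho> differentiable at z" "0 < \<rho> z"
    and e: "norm e = 1" and \<alpha>: "(\<lambda>p. maurer_cartan \<phi> p e) differentiable at z"
  shows "second_fundamental_form neutral \<rho> \<phi> (\<lambda>p. e / of_real (sqrt (\<rho> p))) (\<lambda>p. e / of_real (sqrt (\<rho> p))) z =
    (1 / \<rho> z) *\<^sub>R (\<phi> z ** frechet_derivative (\<lambda>p. maurer_cartan \<phi> p e) (at z) e)
    - (1 / (2 * (\<rho> z)\<^sup>2)) *\<^sub>R frechet_derivative \<phi> (at z)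
        ((2 * frechet_derivative \<rho> (at z) e) *\<^sub>R e - Complex (frechet_derivative \<rho> (at z) 1) (frechet_derivative \<rho> (at z) \<i>))"
proof -
  define s where "s p = 1 / sqrt (\<rho> p)" for p
  define s' where "s' h = - (frechet_derivative \<rho> (at z) h / (2 * \<rho> z * sqrt (\<rho> z)))" for h
  define \<alpha>' where "\<alpha>' = frechet_derivative (\<lambda>p. maurer_cartan \<phi> p e) (at z)"
  define T where "T = frechet_derivative \<phi> (at z)"
  define d where "d = frechet_derivative \<rho> (at z)"
  define g where "g = Complex (d 1) (d \<i>)"
  have Y: "(\<lambda>p. e / of_real (sqrt (\<rho> p))) = (\<lambda>p. s p *\<^sub>R e)"
    by (simp add: s_def scaleR_conv_of_real fun_eq_iff)
  have ss: "s z * s z = 1 / \<rho> z"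
    using \<rho>(2) by (simp add: s_def)
  have s': "(s has_derivative s') (at z)"
    unfolding s_def[abs_def] s'_def[abs_def] using \<rho>
    by (intro has_derivative_inverse_sqrt) (simp_all flip: frechet_derivative_works)
  have T: "(\<phi> has_derivative T) (at z)"
    using \<phi>(1) U unfolding T_def by (simp flip: frechet_derivative_works)
  have linT: "linear T" and lind: "linear d" and lin\<alpha>: "linear \<alpha>'"
    using T \<rho> \<alpha> unfolding d_def \<alpha>'_def
    by (auto dest: has_derivative_linear simp: linear_frechet_derivative)
  have lins: "linear s'"
    using s' by (rule has_derivative_linear)
  have dY: "frechet_derivative (\<lambda>p. s p *\<^sub>R e) (at z) h = s' h *\<^sub>R e" for h
    using frechet_derivative_at[OF has_derivative_scaleR_left[OF s', of e]] by metis
  have dV: "frechet_derivative (\<lambda>p. matrix_inv (\<phi> p) ** frechet_derivative \<phi> (at p) (s p *\<^sub>R e)) (at z) h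
      = s z *\<^sub>R \<alpha>' h + s' h *\<^sub>R maurer_cartan \<phi> z e" for h
  proof -
    have "((\<lambda>p. s p *\<^sub>R maurer_cartan \<phi> p e) has_derivative
        (\<lambda>h. s z *\<^sub>R \<alpha>' h + s' h *\<^sub>R maurer_cartan \<phi> z e)) (at z)"
      using \<alpha> unfolding \<alpha>'_def
      by (intro has_derivative_scaleR s') (simp flip: frechet_derivative_works)
    moreover have "s p *\<^sub>R maurer_cartan \<phi> p e = matrix_inv (\<phi> p) ** frechet_derivative \<phi> (at p) (s p *\<^sub>R e)"
      if "p \<in> U" for p
      using linear_frechet_derivative[OF \<phi>(1)[OF that]]
      by (simp add: maurer_cartan_def linear_scale matmul.scaleR_right)
    ultimately have "((\<lambda>p. matrix_inv (\<phi> p) ** frechet_derivative \<phi> (at p) (s p *\<^sub>R e)) has_derivative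
        (\<lambda>h. s z *\<^sub>R \<alpha>' h + s' h *\<^sub>R maurer_cartan \<phi> z e)) (at z)"
      by (rule has_derivative_transform_within_open[OF _ U])
    from frechet_derivative_at[OF this] show ?thesis
      by metis
  qed
  have mc: "\<phi> z ** maurer_cartan \<phi> z e = T e"
    by (simp add: maurer_cartan_def T_def mult_inv_cancel \<phi>)
  have "levi_civita \<rho> (\<lambda>p. s p *\<^sub>R e) (\<lambda>p. s p *\<^sub>R e) z =
      (s z * s' e) *\<^sub>R e + (1 / (2 * (\<rho> z)\<^sup>2)) *\<^sub>R ((2 * d e) *\<^sub>R e - g)"
  proof -
    have "(s z *\<^sub>R e) \<bullet> (s z *\<^sub>R e) = 1 / \<rho> z"
      using e ss by (simp add: dot_square_norm power2_eq_square)
    moreover have "d (s z *\<^sub>R e) *\<^sub>R (s z *\<^sub>R e) = (1 / \<rho> z) *\<^sub>R (d e *\<^sub>R e)"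
      using ss by (simp add: linear_scale[OF lind] mult_ac)
    ultimately have "levi_civita \<rho> (\<lambda>p. s p *\<^sub>R e) (\<lambda>p. s p *\<^sub>R e) z =
      s' (s z *\<^sub>R e) *\<^sub>R e + (1 / (2 * \<rho> z)) *\<^sub>R ((1 / \<rho> z) *\<^sub>R (d e *\<^sub>R e) + (1 / \<rho> z) *\<^sub>R (d e *\<^sub>R e) - (1 / \<rho> z) *\<^sub>R g)"
      by (simp only: levi_civita_def Let_def dY d_def[symmetric] g_def[symmetric])
    also have "\<dots> = (s z * s' e) *\<^sub>R e + (1 / (2 * (\<rho> z)\<^sup>2)) *\<^sub>R ((2 * d e) *\<^sub>R e - g)"
      unfolding linear_scale[OF lins]
      using \<rho>(2) by (simp add: scaleR_conv_of_real field_simps power2_eq_square)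
    finally show ?thesis .
  qed
  then have "T (levi_civita \<rho> (\<lambda>p. s p *\<^sub>R e) (\<lambda>p. s p *\<^sub>R e) z) =
      (s z * s' e) *\<^sub>R T e + (1 / (2 * (\<rho> z)\<^sup>2)) *\<^sub>R T ((2 * d e) *\<^sub>R e - g)"
    by (simp only: linear_add[OF linT] linear_scale[OF linT])
  moreover have "pullback_connection neutral \<phi> (\<lambda>p. s p *\<^sub>R e)
      (\<lambda>p. frechet_derivative \<phi> (at p) (s p *\<^sub>R e)) z = (1 / \<rho> z) *\<^sub>R (\<phi> z ** \<alpha>' e) + (s z * s' e) *\<^sub>R T e"
  proof -
    have "neutral (maurer_cartan \<phi> z (s z *\<^sub>R e)) (matrix_inv (\<phi> z) ** frechet_derivative \<phi> (at z) (s z *\<^sub>R e)) = 0"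
      by (simp add: maurer_cartan_def neutral_def commutator_def)
    then have "pullback_connection neutral \<phi> (\<lambda>p. s p *\<^sub>R e)
      (\<lambda>p. frechet_derivative \<phi> (at p) (s p *\<^sub>R e)) z =
      \<phi> z ** (s z *\<^sub>R \<alpha>' (s z *\<^sub>R e) + s' (s z *\<^sub>R e) *\<^sub>R maurer_cartan \<phi> z e)"
      by (simp only: pullback_connection_def dV) simp
    also have "\<dots> = (s z * s z) *\<^sub>R (\<phi> z ** \<alpha>' e) + (s z * s' e) *\<^sub>R T e"
      by (simp add: linear_scale[OF lin\<alpha>] linear_scale[OF lins] matmul.add_right matmul.scaleR_right mc)
    finally show ?thesis
      by (simp only: ss)
  qed
  ultimately show ?thesis
    unfolding Y second_fundamental_form_def
    by (simp add: T_def[symmetric] d_def[symmetric] g_def[symmetric] \<alpha>'_def[symmetric])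
qed

text \<open>In the sum over the two coordinate directions the terms with \<open>d\<rho>\<close> cancel; this is the conformal
  invariance of harmonicity in dimension two.\<close>

lemma tension_field_neutral:
  assumes \<phi>: "smooth_frame U \<phi>" and z: "z \<in> U" and \<rho>: "\<rho> differentiable at z" "0 < \<rho> z"
  shows "tension_field neutral \<rho> \<phi> z = (1 / \<rho> z) *\<^sub>R (\<phi> z ** (dx (log_dx \<phi>) z + dy (log_dy \<phi>) z))"
proof -
  note \<Phi> = smooth_frameD[OF \<phi>]
  define T where "T = frechet_derivative \<phi> (at z)"
  define d where "d = frechet_derivative \<rho> (at z)"
  have mc: "(\<lambda>p. maurer_cartan \<phi> p 1) = log_dx \<phi>" "(\<lambda>p. maurer_cartan \<phi> p \<i>) = log_dy \<phi>"
    by (simp_all add: fun_eq_iff maurer_cartan_def log_dx_def log_dy_def dx_def dy_def)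
  have linT: "linear T"
    unfolding T_def by (rule linear_frechet_derivative[OF \<Phi>(4)[OF z]])
  let ?g = "Complex (d 1) (d \<i>)"
  have "T ((2 * d 1) *\<^sub>R 1 - ?g) + T ((2 * d \<i>) *\<^sub>R \<i> - ?g) = T (((2 * d 1) *\<^sub>R 1 - ?g) + ((2 * d \<i>) *\<^sub>R \<i> - ?g))"
    by (simp only: linear_add[OF linT])
  also have "((2 * d 1) *\<^sub>R 1 - ?g) + ((2 * d \<i>) *\<^sub>R \<i> - ?g) = 0"
    by (simp add: complex_eq_iff)
  finally have 0: "T ((2 * d 1) *\<^sub>R 1 - ?g) + T ((2 * d \<i>) *\<^sub>R \<i> - ?g) = 0"
    by (simp only: linear_0[OF linT])
  note sff = second_fundamental_form_neutral[OF \<Phi>(1) z \<Phi>(4) \<Phi>(3)[OF z] \<rho>, folded T_def d_def]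
  have "tension_field neutral \<rho> \<phi> z =
      (1 / \<rho> z) *\<^sub>R (\<phi> z ** dx (log_dx \<phi>) z) + (1 / \<rho> z) *\<^sub>R (\<phi> z ** dy (log_dy \<phi>) z)
      - (1 / (2 * (\<rho> z)\<^sup>2)) *\<^sub>R (T ((2 * d 1) *\<^sub>R 1 - ?g) + T ((2 * d \<i>) *\<^sub>R \<i> - ?g))"
    using sff[of 1] sff[of \<i>] \<Phi>(12,14)[OF z]
    unfolding tension_field_def mc dx_def[of "log_dx \<phi>"] dy_def[of "log_dy \<phi>"]
    by (simp add: scaleR_right_distrib)
  then show ?thesis
    unfolding 0 by (simp add: matmul.add_right scaleR_right_distrib)
qed

lemma harmonic_map_on_neutralI:
  assumes "smooth_frame U \<phi>" "\<And>z. z \<in> U \<Longrightarrow> \<phi> z \<in> G"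
    and "\<And>z. z \<in> U \<Longrightarrow> dx (log_dx \<phi>) z + dy (log_dy \<phi>) z = 0"
  shows "harmonic_map_on neutral G U \<phi>"
  unfolding harmonic_map_on_def
proof (intro conjI allI impI ballI)
  show "smooth_map_on U \<phi>" "\<phi> ` U \<subseteq> G"
    using assms smooth_frameD(2) by auto
  fix \<rho> :: "complex \<Rightarrow> real" and z
  assume "smooth_map_on U \<rho> \<and> (\<forall>z\<in>U. 0 < \<rho> z)" and z: "z \<in> U"
  then have "\<rho> differentiable at z" "0 < \<rho> z"
    using smooth_map_on_imp_differentiable by auto
  from tension_field_neutral[OF assms(1) z this] show "tension_field neutral \<rho> \<phi> z = 0"
    by (simp add: assms(3)[OF z] matmul.zero_right)
qed

text \<open>Here \<open>P\<close>, \<open>P'\<close> stand for a frame at the loop parameters \<open>\<mu>\<close>, \<open>- \<mu>\<close>, and \<open>Q\<close>, \<open>Q'\<close> for the same frame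
  at \<open>\<i> \<mu>\<close>, \<open>- \<i> \<mu>\<close>. Let \<open>(S, T)\<close> be the even and \<open>(X, Y)\<close> the odd part of the logarithmic derivative of the
  frame at \<open>\<mu>\<close>, written in the coordinates \<open>x\<close>, \<open>y\<close>. The hypotheses say that at \<open>\<i> \<mu>\<close> the even part is
  again \<open>(S, T)\<close>, and the odd part is \<open>(- Y, X)\<close>. The odd part of the Maurer-Cartan equation at \<open>\<i> \<mu>\<close> is
  therefore \<open>\<partial>\<^sub>x X + \<partial>\<^sub>y Y + [S, X] + [T, Y] = 0\<close>. In it \<open>S\<close> and \<open>T\<close> may be replaced by \<open>S + X\<close> and \<open>T + Y\<close>, the
  logarithmic derivative of \<open>P\<close>, and the equation then says that \<open>P (X, Y) P\<inverse>\<close> has divergence \<open>0\<close>. The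
  logarithmic derivative of \<open>\<psi>\<close> is \<open>- 2\<close> times this.\<close>

lemma quotient_divergence_eq_0:
  fixes P P' Q Q' :: "complex \<Rightarrow> 'n::finite cmat"
  assumes P: "smooth_frame U P" "smooth_frame U P'" and Q: "smooth_frame U Q" "smooth_frame U Q'"
    and diff: "\<And>z. z \<in> U \<Longrightarrow> log_dx Q z - log_dx Q' z = log_dy P' z - log_dy P z"
      "\<And>z. z \<in> U \<Longrightarrow> log_dy Q z - log_dy Q' z = log_dx P z - log_dx P' z"
    and sum: "\<And>z. z \<in> U \<Longrightarrow> log_dx Q z + log_dx Q' z = log_dx P z + log_dx P' z"
      "\<And>z. z \<in> U \<Longrightarrow> log_dy Q z + log_dy Q' z = log_dy P z + log_dy P' z"
    and z: "z \<in> U"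
  defines "\<psi> \<equiv> \<lambda>z. P' z ** matrix_inv (P z)"
  shows "dx (log_dx \<psi>) z + dy (log_dy \<psi>) z = 0"
proof -
  note P1 = smooth_frameD[OF P(1)] and P2 = smooth_frameD[OF P(2)]
    and Q1 = smooth_frameD[OF Q(1)] and Q2 = smooth_frameD[OF Q(2)]
  have \<psi>: "smooth_frame U \<psi>"
    unfolding \<psi>_def by (rule smooth_frame_mult_inv[OF P(2,1)])
  note \<Psi> = smooth_frameD[OF \<psi>]
  let ?X = "\<lambda>z. log_dx P' z - log_dx P z" and ?Y = "\<lambda>z. log_dy P' z - log_dy P z"
  have dX: "?X differentiable at z" and dY: "?Y differentiable at z"
    by (intro differentiable_diff P1 P2 z)+
  have X: "dx (log_dx \<psi>) z = P z ** (dx ?X z + commutator (log_dx P z) (?X z)) ** matrix_inv (P z)"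
  proof -
    have "dx (log_dx \<psi>) z = dx (\<lambda>z. P z ** ?X z ** matrix_inv (P z)) z"
      by (rule dx_dy_cong[OF \<Psi>(1) z _ \<Psi>(12)[OF z]])
         (use log_derivative_mult_inv(1)[OF P(2,1)] in \<open>simp add: \<psi>_def\<close>)
    then show ?thesis
      by (simp only: dx_dy_conjugate[OF P(1) z dX])
  qed
  have Y: "dy (log_dy \<psi>) z = P z ** (dy ?Y z + commutator (log_dy P z) (?Y z)) ** matrix_inv (P z)"
  proof -
    have "dy (log_dy \<psi>) z = dy (\<lambda>z. P z ** ?Y z ** matrix_inv (P z)) z"
      by (rule dx_dy_cong[OF \<Psi>(1) z _ \<Psi>(14)[OF z]])
         (use log_derivative_mult_inv(2)[OF P(2,1)] in \<open>simp add: \<psi>_def\<close>)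
    then show ?thesis
      by (simp only: dx_dy_conjugate[OF P(1) z dY])
  qed
  have qx: "dx (log_dy Q) z - dx (log_dy Q') z = - dx ?X z"
  proof -
    have "dx (log_dy Q) z - dx (log_dy Q') z = dx (\<lambda>z. log_dy Q z - log_dy Q' z) z"
      by (simp add: dx_dy_diff Q1 Q2 z)
    also have "\<dots> = dx (\<lambda>z. log_dx P z - log_dx P' z) z"
      by (rule dx_dy_cong[OF Q1(1) z diff(2)]) (simp_all add: Q1 Q2 z differentiable_diff)
    finally show ?thesis
      by (simp add: dx_dy_diff P1 P2 z)
  qed
  have qy: "dy (log_dx Q) z - dy (log_dx Q') z = dy ?Y z"
  proof -
    have "dy (log_dx Q) z - dy (log_dx Q') z = dy (\<lambda>z. log_dx Q z - log_dx Q' z) z"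
      by (simp add: dx_dy_diff Q1 Q2 z)
    also have "\<dots> = dy ?Y z"
      by (rule dx_dy_cong[OF Q1(1) z diff(1)]) (simp_all add: Q1 Q2 z differentiable_diff)
    finally show ?thesis .
  qed
  (* the odd part of the bracket in the Maurer-Cartan equation of Q, up to the factor 2 *)
  define a a' b b' p p' q q' where "a = log_dx Q z" "a' = log_dx Q' z" "b = log_dy Q z" "b' = log_dy Q' z"
    "p = log_dx P z" "p' = log_dx P' z" "q = log_dy P z" "q' = log_dy P' z"
  note defs = this
  note ring = commutator_def matmul.add_left matmul.add_right matmul.diff_left matmul.diff_right
  have "2 *\<^sub>R (commutator a b - commutator a' b') =
      commutator (a - a') (b + b') + commutator (a + a') (b - b')"
    by (simp add: ring scaleR_2)
  also have "\<dots> = commutator (q' - q) (q + q') + commutator (p + p') (p - p')"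
    using diff[OF z] sum[OF z] unfolding defs by simp
  also have "\<dots> = - (2 *\<^sub>R (commutator p (p' - p) + commutator q (q' - q)))"
    by (simp add: ring scaleR_2)
  finally have "2 *\<^sub>R ((commutator a b - commutator a' b') + (commutator p (p' - p) + commutator q (q' - q))) = 0"
    by (simp add: scaleR_right_distrib)
  then have alg: "(commutator a b - commutator a' b') + (commutator p (p' - p) + commutator q (q' - q)) = 0"
    by simp
  have "(dx (log_dy Q) z - dy (log_dx Q) z + commutator a b) -
      (dx (log_dy Q') z - dy (log_dx Q') z + commutator a' b') = 0"
    using maurer_cartan_equation[OF Q(1) z] maurer_cartan_equation[OF Q(2) z] unfolding defs by simp
  then have "(dx (log_dy Q) z - dx (log_dy Q') z) - (dy (log_dx Q) z - dy (log_dx Q') z) +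
      (commutator a b - commutator a' b') = 0"
    by (simp add: algebra_simps)
  then have "dx ?X z + dy ?Y z = commutator a b - commutator a' b'"
    unfolding qx qy by (simp add: algebra_simps)
  then have "(dx ?X z + dy ?Y z) + (commutator p (?X z) + commutator q (?Y z)) = 0"
    using alg unfolding defs by (simp only:)
  then have 0: "(dx ?X z + commutator p (?X z)) + (dy ?Y z + commutator q (?Y z)) = 0"
    by (simp only: add_ac)
  have "dx (log_dx \<psi>) z + dy (log_dy \<psi>) z =
      P z ** ((dx ?X z + commutator p (?X z)) + (dy ?Y z + commutator q (?Y z))) ** matrix_inv (P z)"
    unfolding X Y defs by (simp only: matmul.add_left matmul.add_right)
  then show ?thesis
    unfolding 0 by (simp add: matmul.zero_left matmul.zero_right)
qed

section \<open>The potential and the Iwasawa decomposition\<close>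

lemma eventually_not_mat_pole:
  assumes "mat_meromorphic_on f D" "z \<in> D"
  shows "\<forall>\<^sub>F \<zeta> in at z. \<not> mat_pole f \<zeta>"
proof -
  have "\<forall>\<^sub>F \<zeta> in at z. \<not> is_pole (\<lambda>\<zeta>. f \<zeta> $ i $ j) \<zeta>" for i j
  proof -
    have "(\<lambda>\<zeta>. f \<zeta> $ i $ j) meromorphic_on {z}"
      using assms by (auto simp: mat_meromorphic_on_def nicely_meromorphic_on_def intro: meromorphic_on_subset)
    then have "\<forall>\<^sub>F \<zeta> in at z. (\<lambda>\<zeta>. f \<zeta> $ i $ j) analytic_on {\<zeta>}"
      by (simp add: meromorphic_on_isolated_singularity flip: isolated_singularity_at_altdef)
    then show ?thesis
      by eventually_elim (rule analytic_at_imp_no_pole)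
  qed
  then show ?thesis
    by (simp add: mat_pole_def eventually_ball_finite eventually_all_finite)
qed

text \<open>A solution of \<open>dP = P \<xi>\<close> determines \<open>\<xi> = P\<inverse> P'\<close>, which has a limit at every point at which
  \<open>P\<close> is holomorphic and invertible.\<close>

lemma potential_no_pole:
  fixes \<xi> P :: "complex \<Rightarrow> 'n::finite cmat"
  assumes \<xi>: "mat_meromorphic_on \<xi> D" "z \<in> D"
    and P: "\<And>i j. (\<lambda>\<zeta>. P \<zeta> $ i $ j) analytic_on {z}"
    and U: "open U" "z \<in> U" and inv: "\<And>\<zeta>. \<zeta> \<in> U \<Longrightarrow> invertible (P \<zeta>)"
    and sol: "\<And>\<zeta>. \<zeta> \<in> U \<Longrightarrow> \<not> mat_pole \<xi> \<zeta> \<Longrightarrow>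
      (P has_derivative (\<lambda>h. h *\<^sub>m (P \<zeta> ** \<xi> \<zeta>))) (at \<zeta>)"
  shows "\<not> mat_pole \<xi> z"
proof
  assume "mat_pole \<xi> z"
  then obtain i j where pole: "is_pole (\<lambda>\<zeta>. \<xi> \<zeta> $ i $ j) z"
    by (auto simp: mat_pole_def)
  define P' where "P' \<zeta> = (\<chi> i j. deriv (\<lambda>\<zeta>. P \<zeta> $ i $ j) \<zeta>)" for \<zeta>
  have "(\<lambda>\<zeta>. P \<zeta> $ i $ j) \<midarrow>z\<rightarrow> P z $ i $ j" "(\<lambda>\<zeta>. P' \<zeta> $ i $ j) \<midarrow>z\<rightarrow> P' z $ i $ j" for i j
    using analytic_at_imp_isCont[OF P[of i j]] analytic_at_imp_isCont[OF analytic_deriv[OF P[of i j]]]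
    by (simp_all add: isCont_def P'_def)
  then have lim: "P \<midarrow>z\<rightarrow> P z" "P' \<midarrow>z\<rightarrow> P' z"
    by (auto intro!: vec_tendstoI)
  have evU: "\<forall>\<^sub>F \<zeta> in at z. \<zeta> \<in> U"
    using eventually_at_in_open'[OF U] .
  have "(\<lambda>\<zeta>. matrix_inv (P \<zeta>)) \<midarrow>z\<rightarrow> matrix_inv (P z)"
    using evU by (intro tendsto_matrix_inv lim inv U(2)) (auto elim!: eventually_mono intro: inv)
  then have "(\<lambda>\<zeta>. matrix_inv (P \<zeta>) ** P' \<zeta>) \<midarrow>z\<rightarrow> matrix_inv (P z) ** P' z"
    by (intro matmul.tendsto lim)
  moreover have "\<forall>\<^sub>F \<zeta> in at z. matrix_inv (P \<zeta>) ** P' \<zeta> = \<xi> \<zeta>"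
    using evU eventually_not_mat_pole[OF \<xi>]
  proof eventually_elim
    case (elim \<zeta>)
    have "P' \<zeta> $ i $ j = (P \<zeta> ** \<xi> \<zeta>) $ i $ j" for i j
    proof -
      have "((\<lambda>\<zeta>. P \<zeta> $ i $ j) has_derivative (\<lambda>h. (h *\<^sub>m (P \<zeta> ** \<xi> \<zeta>)) $ i $ j)) (at \<zeta>)"
        by (rule bounded_linear.has_derivative[OF bounded_linear_entry sol[OF elim]])
      then have "((\<lambda>\<zeta>. P \<zeta> $ i $ j) has_field_derivative (P \<zeta> ** \<xi> \<zeta>) $ i $ j) (at \<zeta>)"
        by (simp add: has_field_derivative_def mult_commute_abs)
      then show ?thesis
        by (simp add: P'_def DERIV_imp_deriv)
    qed
    then have "P' \<zeta> = P \<zeta> ** \<xi> \<zeta>"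
      by (simp add: vec_eq_iff)
    then show ?case
      using inv[OF elim(1)] by (simp add: mult_inv_cancel)
  qed
  ultimately have "\<xi> \<midarrow>z\<rightarrow> matrix_inv (P z) ** P' z"
    by (simp add: filterlim_cong)
  then have "(\<lambda>\<zeta>. \<xi> \<zeta> $ i $ j) \<midarrow>z\<rightarrow> (matrix_inv (P z) ** P' z) $ i $ j"
    by (rule bounded_linear.tendsto[OF bounded_linear_entry])
  with pole show False
    unfolding is_pole_def using not_tendsto_and_filterlim_at_infinity[of "at z"] by auto
qed

text \<open>The logarithmic derivative \<open>F\<inverse> dF\<close> of the real factor of an Iwasawa decomposition \<open>R = F w\<close> is
  \<open>(\<lambda>\<inverse> w \<xi> dz - dw) w\<inverse>\<close>. It has at most a simple pole at \<open>\<lambda> = 0\<close>, of type \<open>(1,0)\<close>, so reality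
  determines its shape.\<close>

lemma iwasawa_logarithmic_derivative:
  fixes a b v u vx vy :: "complex \<Rightarrow> 'n::finite cmat"
  assumes \<gg>: "totally_real \<gg>"
    and ab: "\<And>l. l \<in> sphere 0 1 \<Longrightarrow> a l \<in> \<gg>" "\<And>l. l \<in> sphere 0 1 \<Longrightarrow> b l \<in> \<gg>"
    and ext: "extends_to_disk v" "extends_to_disk u" "extends_to_disk vx" "extends_to_disk vy"
    and a: "\<And>l. l \<in> sphere 0 1 \<Longrightarrow> a l = (inverse l *\<^sub>m (v l ** \<xi>) - vx l) ** u l"
    and b: "\<And>l. l \<in> sphere 0 1 \<Longrightarrow> b l = ((inverse l * \<i>) *\<^sub>m (v l ** \<xi>) - vy l) ** u l"
  obtains B C A0 B0 where
    "\<And>l. l \<in> sphere 0 1 \<Longrightarrow> a l = inverse l *\<^sub>m B + A0 + l *\<^sub>m C"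
    "\<And>l. l \<in> sphere 0 1 \<Longrightarrow> b l = (inverse l * \<i>) *\<^sub>m B + B0 - (l * \<i>) *\<^sub>m C"
proof -
  obtain v' u' vx' vy' where
    ext': "disk_extension v v'" "disk_extension u u'" "disk_extension vx vx'" "disk_extension vy vy'"
    using ext unfolding extends_to_disk_iff by blast
  let ?B = "v' 0 ** \<xi> ** u' 0"
  have pole: "disk_extension (\<lambda>l. v l ** \<xi> ** u l) (\<lambda>l. v' l ** \<xi> ** u' l)"
    by (intro disk_extension_mult disk_extension_const ext')
  have "disk_extension (\<lambda>l. v l ** \<xi> ** u l - l *\<^sub>m (vx l ** u l)) (\<lambda>l. v' l ** \<xi> ** u' l - l *\<^sub>m (vx' l ** u' l))"
    by (intro disk_extension_diff pole disk_extension_cscale disk_extension_mult ext' continuous_intros)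
       (auto intro: holomorphic_intros)
  then have Ha: "disk_extension (\<lambda>l. l *\<^sub>m a l) (\<lambda>l. v' l ** \<xi> ** u' l - l *\<^sub>m (vx' l ** u' l))"
  proof (rule disk_extension_cong)
    fix l :: complex
    assume l: "l \<in> sphere 0 1"
    then have "l \<noteq> 0"
      by auto
    then show "v l ** \<xi> ** u l - l *\<^sub>m (vx l ** u l) = l *\<^sub>m a l"
      by (simp add: a[OF l] matmul.diff_left cscale.diff_right)
  qed
  have "disk_extension (\<lambda>l. \<i> *\<^sub>m (v l ** \<xi> ** u l) - l *\<^sub>m (vy l ** u l))
      (\<lambda>l. \<i> *\<^sub>m (v' l ** \<xi> ** u' l) - l *\<^sub>m (vy' l ** u' l))"
    by (intro disk_extension_diff pole disk_extension_cscale disk_extension_mult ext' continuous_intros)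
       (auto intro: holomorphic_intros)
  then have Hb: "disk_extension (\<lambda>l. l *\<^sub>m b l) (\<lambda>l. \<i> *\<^sub>m (v' l ** \<xi> ** u' l) - l *\<^sub>m (vy' l ** u' l))"
  proof (rule disk_extension_cong)
    fix l :: complex
    assume l: "l \<in> sphere 0 1"
    then have "l \<noteq> 0"
      by auto
    then show "\<i> *\<^sub>m (v l ** \<xi> ** u l) - l *\<^sub>m (vy l ** u l) = l *\<^sub>m b l"
      by (simp add: b[OF l] matmul.diff_left cscale.diff_right flip: mult.assoc)
  qed
  obtain A0 C where A: "conjugate_wrt \<gg> ?B C"
    "\<And>l. l \<in> sphere 0 1 \<Longrightarrow> a l = inverse l *\<^sub>m ?B + A0 + l *\<^sub>m C"
    by (rule real_loop_with_simple_pole[OF \<gg> ab(1) Ha, unfolded cscale.zero_left diff_0_right])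
       (assumption, rule that)
  obtain B0 C' where B: "conjugate_wrt \<gg> (\<i> *\<^sub>m ?B) C'"
    "\<And>l. l \<in> sphere 0 1 \<Longrightarrow> b l = inverse l *\<^sub>m \<i> *\<^sub>m ?B + B0 + l *\<^sub>m C'"
    by (rule real_loop_with_simple_pole[OF \<gg> ab(2) Hb, unfolded cscale.zero_left diff_0_right])
       (assumption, rule that)
  have "C' = - (\<i> *\<^sub>m C)"
    using conjugate_wrt_unique[OF \<gg> B(1) conjugate_wrt_i[OF \<gg> A(1)]] .
  with B(2) have "b l = (inverse l * \<i>) *\<^sub>m ?B + B0 - (l * \<i>) *\<^sub>m C" if "l \<in> sphere 0 1" for l
    using that by (simp add: cscale.minus_right)
  with A(2) show ?thesis
    using that by blast
qed

lemma part10_part01: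
  assumes "\<And>h. \<alpha> h = h *\<^sub>m P + cnj h *\<^sub>m Q"
  shows "part10 \<alpha> h = h *\<^sub>m P" "part01 \<alpha> h = cnj h *\<^sub>m Q"
proof -
  have i: "\<i> *\<^sub>m \<alpha> (\<i> * h) = - (h *\<^sub>m P) + cnj h *\<^sub>m Q"
    by (simp add: assms vec_eq_iff algebra_simps)
  show "part10 \<alpha> h = h *\<^sub>m P" "part01 \<alpha> h = cnj h *\<^sub>m Q"
    unfolding part10_def part01_def i by (simp_all add: assms flip: scaleR_2)
qed

theorem theorem5p14:
  fixes G GC :: "'n::finite cmat set"
    and w :: "int \<Rightarrow> real"
    and D U :: "complex set" and z0 :: complex
    and \<xi> :: "complex \<Rightarrow> 'n cmat"
    and R W :: "complex \<Rightarrow> complex \<Rightarrow> 'n cmat \<times> 'n cmat"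
    and F F_hat :: "complex \<Rightarrow> complex \<Rightarrow> 'n cmat"
    and \<phi> :: "complex \<Rightarrow> 'n cmat"
  assumes G: "linear_complexification G GC" "simply_connected GC"
    and w: "admissible_weight w"
    and D: "open D" "connected D" "simply_connected D"
    and xi: "mat_meromorphic_on \<xi> D"
      "\<And>z. z \<in> D \<Longrightarrow> \<not> mat_pole \<xi> z \<Longrightarrow> \<xi> z \<in> complexify (lie_algebra G)"
    and R_meromorphic: "loop_meromorphic_on R D"
    and R_twisted: "\<And>z. z \<in> D \<Longrightarrow> \<not> loop_pole R z \<Longrightarrow> R z \<in> twisted (loop_group w GC)"
    and R_solution: "\<And>z l. z \<in> D \<Longrightarrow> \<not> mat_pole \<xi> z \<Longrightarrow> \<not> loop_pole R z \<Longrightarrow> l \<in> sphere 0 1 \<Longrightarrow>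
      ((\<lambda>\<zeta>. R \<zeta> l) has_derivative (\<lambda>h. R z l **\<^sub>2 potential \<xi> z l h)) (at z)"
    and R_initial: "z0 \<in> D" "\<not> loop_pole R z0" "\<And>l. l \<in> sphere 0 1 \<Longrightarrow> R z0 l \<in> GC \<times> GC"
    and U: "open U" "U \<subseteq> {z \<in> D. \<not> loop_pole R z \<and> R z \<in> iwasawa_big_cell w G GC}"
    and F: "\<And>z. z \<in> U \<Longrightarrow> (\<lambda>l. (F z l, F z (- l))) \<in> twisted (loop_group w G)"
    and W: "\<And>z. z \<in> U \<Longrightarrow> W z \<in> twisted (plus_loop_group w GC)"
    and iwasawa: "\<And>z l. z \<in> U \<Longrightarrow> l \<in> sphere 0 1 \<Longrightarrow> R z l = (F z l, F z (- l)) **\<^sub>2 W z l"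
    and smooth: "smooth_loop_map_on w U F"
      "smooth_loop_map_on w U (\<lambda>z l. fst (W z l))" "smooth_loop_map_on w U (\<lambda>z l. snd (W z l))"
    and F_hat: "\<And>z l. F_hat z l = F z l ** matrix_inv (F z 1)"
    and phi: "\<And>z. \<phi> z = F_hat z (- 1)"
  shows "harmonic_map_on neutral G U \<phi> \<and>
    (\<forall>l\<in>sphere 0 1. harmonic_map_on neutral G U (\<lambda>z. F_hat z (- l) ** matrix_inv (F_hat z l))) \<and>
    extended_solution G U \<phi> F_hat"
proof -
  have groups: "mat_subgroup G" "mat_subgroup GC"
    using G(1) by (auto simp: linear_complexification_def connected_linear_lie_group_def)
  have quot: "A ** matrix_inv B \<in> G" if "A \<in> G" "B \<in> G" for A B
    using groups(1) that by (simp add: mat_subgroup_def)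
  have inv: "invertible A" if "A \<in> G \<or> A \<in> GC" for A
    using groups that by (auto simp: mat_subgroup_def)
  have F_in: "F z l \<in> G" if z: "z \<in> U" and l: "l \<in> sphere 0 1" for z l
  proof -
    obtain g where "g \<in> loop_group w G" "\<forall>l\<in>sphere 0 1. (F z l, F z (- l)) = (g l, g (- l))"
      using F[OF z] by (auto simp: twisted_def)
    with l show ?thesis
      by (auto simp: loop_group_def)
  qed
  have frame: "smooth_frame U (\<lambda>z. F z l)" if "l \<in> sphere 0 1" for l
    unfolding smooth_frame_def
    using that F_in inv U(1) smooth_loop_map_on_imp_smooth_map_on[OF w U(1) that smooth(1)] by blast
  define v where "v z l = fst (W z l)" for z l
  have v: "extends_to_disk (v z)" "extends_to_disk (\<lambda>l. matrix_inv (v z l))"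
    "\<And>l. l \<in> sphere 0 1 \<Longrightarrow> invertible (v z l)" if z: "z \<in> U" for z
  proof -
    obtain g where g: "g \<in> plus_loop_group w GC" "\<forall>l\<in>sphere 0 1. W z l = (g l, g (- l))"
      using W[OF z] by (auto simp: twisted_def)
    then have vg: "v z l = g l" if "l \<in> sphere 0 1" for l
      using that by (simp add: v_def)
    obtain h h' where "disk_extension g h" "disk_extension (\<lambda>l. matrix_inv (g l)) h'"
      using g(1) by (auto simp: plus_loop_group_def extends_to_disk_iff)
    then have "disk_extension (v z) h" "disk_extension (\<lambda>l. matrix_inv (v z l)) h'"
      by (auto elim!: disk_extension_cong simp: vg)
    then show "extends_to_disk (v z)" "extends_to_disk (\<lambda>l. matrix_inv (v z l))"
      unfolding extends_to_disk_iff by auto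
    show "invertible (v z l)" if "l \<in> sphere 0 1" for l
      using g(1) that inv by (simp add: vg plus_loop_group_def loop_group_def)
  qed
  define P where "P z l = fst (R z l)" for z l
  have P: "P z l = F z l ** v z l" if "z \<in> U" "l \<in> sphere 0 1" for z l
    using iwasawa[OF that] by (simp add: P_def v_def pair_mult_def)
  have P_inv: "invertible (P z l)" if "z \<in> U" "l \<in> sphere 0 1" for z l
    using that F_in inv v(3) by (simp add: P invertible_mult)
  have P_sol: "((\<lambda>\<zeta>. P \<zeta> l) has_derivative (\<lambda>h. (inverse l * h) *\<^sub>m (P z l ** \<xi> z))) (at z)"
    if "z \<in> U" "\<not> mat_pole \<xi> z" "l \<in> sphere 0 1" for z l
  proof -
    have "((\<lambda>\<zeta>. R \<zeta> l) has_derivative (\<lambda>h. R z l **\<^sub>2 potential \<xi> z l h)) (at z)"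
      using that U by (intro R_solution) auto
    from has_derivative_fst[OF this] show ?thesis
      by (simp add: P_def pair_mult_def potential_def)
  qed
  (* the equation for R is only given away from the poles of \<xi>, but there are none in U *)
  have no_pole: "\<not> mat_pole \<xi> z" if "z \<in> U" for z
  proof (rule potential_no_pole[of \<xi> D z "\<lambda>z. P z 1"])
    have "(\<lambda>z. P z 1 $ i $ j) nicely_meromorphic_on D" "\<not> is_pole (\<lambda>z. P z 1 $ i $ j) z" for i j
      using R_meromorphic U that
      by (auto simp: loop_meromorphic_on_def mat_meromorphic_on_def loop_pole_def mat_pole_def P_def)
    then show "(\<lambda>z. P z 1 $ i $ j) analytic_on {z}" for i j
      using that U by (intro nicely_meromorphic_on_imp_analytic_at[of _ D]) auto
    show "((\<lambda>z. P z 1) has_derivative (\<lambda>h. h *\<^sub>m (P \<zeta> 1 ** \<xi> \<zeta>))) (at \<zeta>)"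
      if "\<zeta> \<in> U" "\<not> mat_pole \<xi> \<zeta>" for \<zeta>
      using P_sol[OF that, of 1] by simp
  qed (use that U xi(1) P_inv in auto)

  have "loop_Ck_on w (Suc 0) U v"
    using smooth(2) unfolding smooth_loop_map_on_def v_def[abs_def] by blast
  then have v_loop: "\<And>z. z \<in> U \<Longrightarrow> wiener_loop w (v z)"
    and "\<exists>vx vy. (\<forall>z\<in>U. ((\<lambda>h. wiener_norm w (\<lambda>l. v (z + h) l - v z l
      - (Re h *\<^sub>R vx z l + Im h *\<^sub>R vy z l)) / norm h) \<longlongrightarrow> 0) (at 0)) \<and>
      loop_Ck_on w 0 U vx \<and> loop_Ck_on w 0 U vy"
    by simp_all
  then obtain vx vy where v_lim: "\<And>z. z \<in> U \<Longrightarrow> ((\<lambda>h. wiener_norm w (\<lambda>l. v (z + h) l - v z l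
      - (Re h *\<^sub>R vx z l + Im h *\<^sub>R vy z l)) / norm h) \<longlongrightarrow> 0) (at 0)"
    and vxy: "loop_Ck_on w 0 U vx" "loop_Ck_on w 0 U vy"
    by blast
  note vxy_loop = vxy[THEN loop_Ck_on_imp_wiener_loop]
  note v_unif = loop_derivative_uniform[OF w U(1) _ v_loop vxy_loop v_lim]
  have v_ext: "extends_to_disk (vx z)" "extends_to_disk (vy z)" if "z \<in> U" for z
    using extends_to_disk_derivative[OF U(1) that v(1) v_unif, of 1]
      extends_to_disk_derivative[OF U(1) that v(1) v_unif, of \<i>] that by simp_all

  (* differentiate P = F v and solve for the derivative of F *)
  have log: "log_dx (\<lambda>z. F z l) z = (inverse l *\<^sub>m (v z l ** \<xi> z) - vx z l) ** matrix_inv (v z l)"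
    "log_dy (\<lambda>z. F z l) z = ((inverse l * \<i>) *\<^sub>m (v z l ** \<xi> z) - vy z l) ** matrix_inv (v z l)"
    if z: "z \<in> U" and l: "l \<in> sphere 0 1" for z l
  proof -
    note Fl = smooth_frameD[OF frame[OF l]]
    have "((\<lambda>z. F z l ** v z l) has_derivative (\<lambda>h. F z l ** (Re h *\<^sub>R vx z l + Im h *\<^sub>R vy z l)
        + (Re h *\<^sub>R dx (\<lambda>z. F z l) z + Im h *\<^sub>R dy (\<lambda>z. F z l) z) ** v z l)) (at z)"
      by (intro matmul.FDERIV has_derivative_dx_dy Fl z has_derivative_of_loop_derivative[OF v_unif l])
    moreover have "((\<lambda>z. F z l ** v z l) has_derivative (\<lambda>h. (inverse l * h) *\<^sub>m (P z l ** \<xi> z))) (at z)"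
      by (rule has_derivative_transform_within_open[OF P_sol[OF z no_pole[OF z] l] U(1) z])
         (rule P[OF _ l])
    ultimately have "(\<lambda>h. F z l ** (Re h *\<^sub>R vx z l + Im h *\<^sub>R vy z l)
        + (Re h *\<^sub>R dx (\<lambda>z. F z l) z + Im h *\<^sub>R dy (\<lambda>z. F z l) z) ** v z l)
        = (\<lambda>h. (inverse l * h) *\<^sub>m (P z l ** \<xi> z))"
      by (rule has_derivative_unique)
    from fun_cong[OF this, of 1] fun_cong[OF this, of \<i>]
    have "dx (\<lambda>z. F z l) z ** v z l = inverse l *\<^sub>m (F z l ** v z l ** \<xi> z) - F z l ** vx z l"
      "dy (\<lambda>z. F z l) z ** v z l = (inverse l * \<i>) *\<^sub>m (F z l ** v z l ** \<xi> z) - F z l ** vy z l"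
      by (simp_all add: P[OF z l] algebra_simps)
    then have "matrix_inv (F z l) ** (dx (\<lambda>z. F z l) z ** v z l) ** matrix_inv (v z l) =
        matrix_inv (F z l) ** (inverse l *\<^sub>m (F z l ** v z l ** \<xi> z) - F z l ** vx z l) ** matrix_inv (v z l)"
      "matrix_inv (F z l) ** (dy (\<lambda>z. F z l) z ** v z l) ** matrix_inv (v z l) =
        matrix_inv (F z l) ** ((inverse l * \<i>) *\<^sub>m (F z l ** v z l ** \<xi> z) - F z l ** vy z l) ** matrix_inv (v z l)"
      by simp_all
    then show "log_dx (\<lambda>z. F z l) z = (inverse l *\<^sub>m (v z l ** \<xi> z) - vx z l) ** matrix_inv (v z l)"
      "log_dy (\<lambda>z. F z l) z = ((inverse l * \<i>) *\<^sub>m (v z l ** \<xi> z) - vy z l) ** matrix_inv (v z l)"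
      unfolding log_dx_def log_dy_def
      by (simp_all add: matmul.diff_right matrix_mul_assoc mult_inv_cancel matrix_inv_inverse v(3)[OF z l] Fl(3)[OF z])
  qed
  have form: "\<exists>B C A0 B0. \<forall>l\<in>sphere 0 1.
      log_dx (\<lambda>z. F z l) z = inverse l *\<^sub>m B + A0 + l *\<^sub>m C \<and>
      log_dy (\<lambda>z. F z l) z = (inverse l * \<i>) *\<^sub>m B + B0 - (l * \<i>) *\<^sub>m C" if z: "z \<in> U" for z
  proof -
    have in_alg: "log_dx (\<lambda>z. F z l) z \<in> lie_algebra G" "log_dy (\<lambda>z. F z l) z \<in> lie_algebra G"
      if l: "l \<in> sphere 0 1" for l
    proof -
      note Fl = smooth_frameD(2)[OF frame[OF l]]
      note in_alg = logarithmic_derivative_in_lie_algebra[OF groups(1) U(1) z Fl F_in[OF _ l]]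
      show "log_dx (\<lambda>z. F z l) z \<in> lie_algebra G" "log_dy (\<lambda>z. F z l) z \<in> lie_algebra G"
        using in_alg[of 1] in_alg[of \<i>] by (simp_all add: log_dx_def log_dy_def)
    qed
    show ?thesis
      using iwasawa_logarithmic_derivative[OF totally_real_lie_algebra[OF G(1)] in_alg v(1,2)[OF z]
        v_ext[OF z] log[OF z]] by metis
  qed

  have harmonic: "harmonic_map_on neutral G U \<psi>"
    if \<mu>: "\<mu> \<in> sphere 0 1" and \<psi>: "\<And>z. z \<in> U \<Longrightarrow> F z (- \<mu>) ** matrix_inv (F z \<mu>) = \<psi> z" for \<mu> \<psi>
  proof -
    have circle: "- \<mu> \<in> sphere 0 1" "\<i> * \<mu> \<in> sphere 0 1" "- (\<i> * \<mu>) \<in> sphere 0 1"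
      using \<mu> by (simp_all add: norm_mult)
    note fr = frame[OF \<mu>] frame[OF circle(1)] frame[OF circle(2)] frame[OF circle(3)]
  (* the inverse of \<i> * \<mu> is - \<i> times that of \<mu>, so passing from \<mu> to \<i> * \<mu> rotates the pair of
     coefficients of dx and dy in the odd part *)
    have rel: "log_dx (\<lambda>z. F z (\<i> * \<mu>)) z - log_dx (\<lambda>z. F z (- (\<i> * \<mu>))) z
        = log_dy (\<lambda>z. F z (- \<mu>)) z - log_dy (\<lambda>z. F z \<mu>) z"
      "log_dy (\<lambda>z. F z (\<i> * \<mu>)) z - log_dy (\<lambda>z. F z (- (\<i> * \<mu>))) z
        = log_dx (\<lambda>z. F z \<mu>) z - log_dx (\<lambda>z. F z (- \<mu>)) z"
      "log_dx (\<lambda>z. F z (\<i> * \<mu>)) z + log_dx (\<lambda>z. F z (- (\<i> * \<mu>))) z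
        = log_dx (\<lambda>z. F z \<mu>) z + log_dx (\<lambda>z. F z (- \<mu>)) z"
      "log_dy (\<lambda>z. F z (\<i> * \<mu>)) z + log_dy (\<lambda>z. F z (- (\<i> * \<mu>))) z
        = log_dy (\<lambda>z. F z \<mu>) z + log_dy (\<lambda>z. F z (- \<mu>)) z" if z: "z \<in> U" for z
    proof -
      obtain B C A0 B0 where
        x: "\<And>l. l \<in> sphere 0 1 \<Longrightarrow> log_dx (\<lambda>z. F z l) z = inverse l *\<^sub>m B + A0 + l *\<^sub>m C" and
        y: "\<And>l. l \<in> sphere 0 1 \<Longrightarrow> log_dy (\<lambda>z. F z l) z = (inverse l * \<i>) *\<^sub>m B + B0 - (l * \<i>) *\<^sub>m C"
        using form[OF z] by blast
      note eqs = x[OF \<mu>] x[OF circle(1)] x[OF circle(2)] x[OF circle(3)]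
        y[OF \<mu>] y[OF circle(1)] y[OF circle(2)] y[OF circle(3)]
      show "log_dx (\<lambda>z. F z (\<i> * \<mu>)) z - log_dx (\<lambda>z. F z (- (\<i> * \<mu>))) z
          = log_dy (\<lambda>z. F z (- \<mu>)) z - log_dy (\<lambda>z. F z \<mu>) z"
        "log_dy (\<lambda>z. F z (\<i> * \<mu>)) z - log_dy (\<lambda>z. F z (- (\<i> * \<mu>))) z
          = log_dx (\<lambda>z. F z \<mu>) z - log_dx (\<lambda>z. F z (- \<mu>)) z"
        "log_dx (\<lambda>z. F z (\<i> * \<mu>)) z + log_dx (\<lambda>z. F z (- (\<i> * \<mu>))) z
          = log_dx (\<lambda>z. F z \<mu>) z + log_dx (\<lambda>z. F z (- \<mu>)) z"
        "log_dy (\<lambda>z. F z (\<i> * \<mu>)) z + log_dy (\<lambda>z. F z (- (\<i> * \<mu>))) z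
          = log_dy (\<lambda>z. F z \<mu>) z + log_dy (\<lambda>z. F z (- \<mu>)) z"
        unfolding eqs by (simp_all add: vec_eq_iff algebra_simps)
    qed
    note cong = smooth_frame_cong[of U "\<lambda>z. F z (- \<mu>) ** matrix_inv (F z \<mu>)" \<psi>,
        OF smooth_frame_mult_inv[OF fr(2,1)] \<psi>]
    show ?thesis
    proof (rule harmonic_map_on_neutralI)
      show "\<psi> z \<in> G" if "z \<in> U" for z
        using \<psi>[OF that] quot[OF F_in[OF that circle(1)] F_in[OF that \<mu>]] by simp
      show "dx (log_dx \<psi>) z + dy (log_dy \<psi>) z = 0" if "z \<in> U" for z
        unfolding cong(2)[OF _ that, simplified] cong(3)[OF _ that, simplified]
        by (rule quotient_divergence_eq_0[OF fr rel that])
    qed (rule cong(1))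
  qed

  have one: "(1 :: complex) \<in> sphere 0 1"
    by simp
  have \<phi>_eq: "\<phi> = (\<lambda>z. F_hat z (- 1))"
    by (simp add: phi fun_eq_iff)
  have "harmonic_map_on neutral G U \<phi>"
    by (rule harmonic[OF one]) (simp add: phi F_hat)
  moreover have "harmonic_map_on neutral G U (\<lambda>z. F_hat z (- l) ** matrix_inv (F_hat z l))"
    if l: "l \<in> sphere 0 1" for l
  proof (rule harmonic[OF l])
    fix z
    assume z: "z \<in> U"
    have "invertible (F z 1)" "invertible (F z l)"
      using F_in[OF z] one l inv by blast+
    then show "F z (- l) ** matrix_inv (F z l) = F_hat z (- l) ** matrix_inv (F_hat z l)"
      by (simp add: F_hat matrix_inv_mult invertible_matrix_inv matrix_inv_matrix_inv matrix_mul_assoc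
          mult_inv_cancel)
  qed
  moreover have "extended_solution G U \<phi> F_hat"
    unfolding extended_solution_def
  proof (intro ballI conjI allI)
    fix l :: complex
    assume l: "l \<in> sphere 0 1"
    have hat_frame: "smooth_frame U (\<lambda>z. F_hat z l)" if "l \<in> sphere 0 1" for l
      unfolding F_hat by (rule smooth_frame_mult_inv[OF frame[OF that] frame[OF one]])
    show "smooth_map_on U (\<lambda>z. F_hat z l)"
      by (rule smooth_frameD(2)[OF hat_frame[OF l]])
    fix z
    assume z: "z \<in> U"
    show "F_hat z l \<in> G"
      unfolding F_hat by (rule quot[OF F_in[OF z l] F_in[OF z one]])
    fix h
    obtain B C A0 B0 where
      x: "\<And>l. l \<in> sphere 0 1 \<Longrightarrow> log_dx (\<lambda>z. F z l) z = inverse l *\<^sub>m B + A0 + l *\<^sub>m C" and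
      y: "\<And>l. l \<in> sphere 0 1 \<Longrightarrow> log_dy (\<lambda>z. F z l) z = (inverse l * \<i>) *\<^sub>m B + B0 - (l * \<i>) *\<^sub>m C"
      using form[OF z] by blast
    (* the difference of F\<inverse> dF at l and at 1 is free of A0 and B0 *)
    define B' where "B' = F z 1 ** B ** matrix_inv (F z 1)"
    define C' where "C' = F z 1 ** C ** matrix_inv (F z 1)"
    have mc: "maurer_cartan (\<lambda>z. F_hat z l) z h = ((inverse l - 1) * h) *\<^sub>m B' + ((l - 1) * cnj h) *\<^sub>m C'"
      if l: "l \<in> sphere 0 1" for l h
    proof -
      have "maurer_cartan (\<lambda>z. F_hat z l) z h = F z 1 **
          (Re h *\<^sub>R (log_dx (\<lambda>z. F z l) z - log_dx (\<lambda>z. F z 1) z)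
           + Im h *\<^sub>R (log_dy (\<lambda>z. F z l) z - log_dy (\<lambda>z. F z 1) z)) ** matrix_inv (F z 1)"
        unfolding maurer_cartan_eq[OF smooth_frameD(4)[OF hat_frame[OF l] z]]
        unfolding F_hat log_derivative_mult_inv[OF frame[OF l] frame[OF one] z]
        by (simp only: matmul.add_left matmul.add_right matmul.scaleR_left matmul.scaleR_right)
      also have "Re h *\<^sub>R (log_dx (\<lambda>z. F z l) z - log_dx (\<lambda>z. F z 1) z)
           + Im h *\<^sub>R (log_dy (\<lambda>z. F z l) z - log_dy (\<lambda>z. F z 1) z)
           = ((inverse l - 1) * h) *\<^sub>m B + ((l - 1) * cnj h) *\<^sub>m C"
        unfolding x[OF l] x[OF one] y[OF l] y[OF one] cscale_of_real[symmetric]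
        by (subst (1 2) complex_eq[of h]) (simp add: vec_eq_iff algebra_simps)
      finally show ?thesis
        by (simp add: matmul.add_left matmul.add_right B'_def C'_def)
    qed
    have "maurer_cartan \<phi> z h = h *\<^sub>m (-2) *\<^sub>m B' + cnj h *\<^sub>m (-2) *\<^sub>m C'" for h
      unfolding \<phi>_eq using mc[of "- 1" h] by (simp add: mult.commute)
    note parts = part10_part01[OF this]
    show "maurer_cartan (\<lambda>\<zeta>. F_hat \<zeta> l) z h =
        ((1 - inverse l) / 2) *\<^sub>m part10 (maurer_cartan \<phi> z) h + ((1 - l) / 2) *\<^sub>m part01 (maurer_cartan \<phi> z) h"
      unfolding mc[OF l] parts by (simp add: vec_eq_iff diff_divide_distrib algebra_simps)
  qed
  ultimately show ?thesis
    by blast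
qed

end
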